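(* Let $(p_{ij})_{i,j\in\{0,1\}}$ be a transition matrix with $p_{ij}\in(0,1)$ for all $i,j\in\{0,1\}$ and $p_{ij}\neq\frac12$ for some $(i,j)\in\{0,1\}^2$. Let $\mu=\mu_0\delta_0+\mu_1\delta_1$ be any initial distribution on $\{0,1\}$, and let $L_n^\mu$ be the external path length of the binary trie built from $n$ strings under the Markov source model with initial distribution $\mu$ and transition matrix $(p_{ij})$. Then, as $n\to\infty$, $$\frac{L_n^\mu-\mathbb{E}[L_n^\mu]}{\sqrt{n\log n}}\stackrel{d}{\longrightarrow}\mathcal{N}(0,\sigma^2),$$ where $\sigma^2>0$ is independent of the initial distribution $\mu$ and given by $$\sigma^2=\frac{\ddot{\lambda}(-1)-\dot{\lambda}(-1)^2}{\dot{\lambda}(-1)^3}.$$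
   Context: Markov source model: $n$ independent, identically distributed infinite binary strings; each string $\xi_1\xi_2\xi_3\ldots$ is a trajectory of the homogeneous Markov chain on $\{0,1\}$ with $\mathbb{P}(\xi_1=i)=\mu_i$ (where $\mu_0,\mu_1\in[0,1]$, $\mu_0+\mu_1=1$) and $\mathbb{P}(\xi_{k+1}=j\mid \xi_k=i)=p_{ij}$. Trie: each string is identified with an infinite path from the root in the infinite complete rooted binary tree (bit $0$ = go left, bit $1$ = go right, starting with the first bit at the root). Each string is stored in the unique node on its path that is closest to the root and does not belong to the path of any other of the $n$ strings (this is well defined almost surely). The external path length $L_n^\mu$ is the sum of the depths (distances to the root) of the $n$ nodes storing the strings; $L_0^\mu=L_1^\mu=0$. $\lambda(s)$ denotes the largest eigenvalue of the matrix $P(s):=(p_{ij}^{-s})_{i,j\in\{0,1\}}$ for real $s$; it is a smooth function of $s$, and $\dot\lambda,\ddot\lambda$ denote its first and second derivatives. $\log$ is the natural logarithm, $\delta_x$ is the Dirac measure at $x$, $\mathcal{N}(0,\sigma^2)$ is the centered normal distribution with variance $\sigma^2$, and $\stackrel{d}{\longrightarrow}$ denotes convergence in distribution. *)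

theory Defs
  imports "HOL-Probability.Probability" "Jordan_Normal_Form.Char_Poly"
begin

(* Bits are booleans: False is 0, True is 1. A node of the infinite complete binary
   tree is the finite bit list leading to it from the root; its depth is its length. *)

(* The stream entry at position k is the bit xi_(k+1). The last clause is the Markov
   property with homogeneous transitions: given any history w of positive probability,
   the next bit is j with probability p (last w) j. *)
definition markov_chain ::
  "'a measure \<Rightarrow> (bool \<Rightarrow> real) \<Rightarrow> (bool \<Rightarrow> bool \<Rightarrow> real) \<Rightarrow> ('a \<Rightarrow> bool stream) \<Rightarrow> bool"
  where
  "markov_chain M \<mu> p \<xi> \<longleftrightarrow>
     \<xi> \<in> measurable M (stream_space (count_space UNIV)) \<and>
     (\<forall>i. \<P>(\<omega> in M. \<xi> \<omega> !! 0 = i) = \<mu> i) \<and>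
     (\<forall>w j. w \<noteq> [] \<longrightarrow> \<P>(\<omega> in M. stake (length w) (\<xi> \<omega>) = w) > 0 \<longrightarrow>
        \<P>(\<omega> in M. \<xi> \<omega> !! length w = j \<bar> stake (length w) (\<xi> \<omega>) = w) = p (last w) j)"

definition markov_source ::
  "'a measure \<Rightarrow> (bool \<Rightarrow> real) \<Rightarrow> (bool \<Rightarrow> bool \<Rightarrow> real) \<Rightarrow> nat \<Rightarrow> (nat \<Rightarrow> 'a \<Rightarrow> bool stream) \<Rightarrow> bool"
  where
  "markov_source M \<mu> p n X \<longleftrightarrow>
     prob_space M \<and>
     prob_space.indep_vars M (\<lambda>_. stream_space (count_space UNIV)) X {..<n} \<and>
     (\<forall>i<n. markov_chain M \<mu> p (X i))"

definition path_nodes :: "bool stream \<Rightarrow> bool list set" where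
  "path_nodes s = range (\<lambda>k. stake k s)"

(* Unspecified (but some fixed node) when the i-th string coincides with another one,
   which happens with probability 0. *)
definition trie_node :: "nat \<Rightarrow> (nat \<Rightarrow> bool stream) \<Rightarrow> nat \<Rightarrow> bool list" where
  "trie_node n s i =
     (ARG_MIN length v. v \<in> path_nodes (s i) \<and> (\<forall>j<n. j \<noteq> i \<longrightarrow> v \<notin> path_nodes (s j)))"

(* For n \<le> 1 this is 0: a single string is stored at the root. *)
definition external_path_length :: "nat \<Rightarrow> (nat \<Rightarrow> bool stream) \<Rightarrow> nat" where
  "external_path_length n s = (\<Sum>i<n. length (trie_node n s i))"

definition P_mat :: "(bool \<Rightarrow> bool \<Rightarrow> real) \<Rightarrow> real \<Rightarrow> real mat" where
  "P_mat p s = mat 2 2 (\<lambda>(i, j). p (i = 1) (j = 1) powr (- s))"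

(* For positive p both eigenvalues of this 2x2 matrix are real. *)
definition lead_eigenvalue :: "(bool \<Rightarrow> bool \<Rightarrow> real) \<Rightarrow> real \<Rightarrow> real" where
  "lead_eigenvalue p s = Max {x. eigenvalue (P_mat p s) x}"

definition limit_variance :: "(bool \<Rightarrow> bool \<Rightarrow> real) \<Rightarrow> real" where
  "limit_variance p =
     (deriv (deriv (lead_eigenvalue p)) (-1) - (deriv (lead_eigenvalue p) (-1))\<^sup>2)
       / (deriv (lead_eigenvalue p) (-1)) ^ 3"

end

theory Submission
  imports Defs "HOL-Real_Asymp.Real_Asymp"
begin

text \<open>
  The external path length is \<open>L = \<Sum>\<^sub>i D\<^sub>i\<close>, where \<open>D\<^sub>i\<close> is the number of nodes on the path of
  string \<open>i\<close> that some other string visits as well. A node \<open>v\<close> of probability \<open>\<pi>\<^sub>v\<close> is visited by about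
  \<open>n \<pi>\<^sub>v\<close> strings, so \<open>D\<^sub>i\<close> should be close to the number \<open>D\<^sub>i'\<close> of nodes on the path with \<open>n \<pi>\<^sub>v > 1\<close>.
  The latter is a function of string \<open>i\<close> alone: it is the time at which the additive functional
  \<open>\<Sum> - ln p\<^sub>x\<^sub>y\<close> of the chain first reaches \<open>ln n\<close>. The \<open>D\<^sub>i'\<close> are independent and identically
  distributed, and renewal theory predicts a variance \<open>\<sigma>\<^sup>2 ln n\<close> for each of them. That is where the
  scaling \<open>sqrt (n ln n)\<close> and the constant come from. The proof has four ingredients.

  \<^item> The difference \<open>L - \<Sum>\<^sub>i D\<^sub>i'\<close> has variance \<open>O(n)\<close>, hence is negligible
    (\<open>variance_level_sum\<close>). By the Efron-Stein inequality (\<open>efron_stein_Pi_pmf\<close>) it is enough that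
    removing one string changes the difference by an amount with bounded second moment. Along the path
    of that string the change at a node \<open>v\<close> vanishes unless \<open>n \<pi>\<^sub>v\<close> is large but at most one other string
    is there, or \<open>n \<pi>\<^sub>v\<close> is small but another string is there. Both have probability
    \<open>O(min (n \<pi>\<^sub>v) (1 / (n \<pi>\<^sub>v)))\<close>, and since \<open>\<pi>\<^sub>v\<close> decays geometrically along the path, even
    the square roots of these probabilities have a bounded sum (\<open>removal_second_moment\<close>).

  \<^item> The passage time \<open>D\<^sub>i'\<close> is replaced by a martingale. Subtracting the drift and a solution of the
    Poisson equation from \<open>\<Sum> - ln p\<^sub>x\<^sub>y\<close> leaves a martingale, and stopping it at the passage time gives
    \<open>W\<close> with \<open>W = ln n - m D' + O(1)\<close> (\<open>stopped_sum_passage\<close>), where \<open>m\<close> is the entropy rate. Its mean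
    is zero and, by a second Poisson equation, its second moment is \<open>(v / m) ln n + O(1)\<close>, where \<open>v\<close> is
    the stationary mean of the squared increments (\<open>stopped_sum_second_moment\<close>). Since
    \<open>\<bar>W\<bar> = O(ln n)\<close>, the sum of \<open>n\<close> independent copies, divided by \<open>m sqrt (n ln n)\<close>, tends to a
    normal law of variance \<open>v / m\<^sup>3\<close> (\<open>char_row_sums_tendsto\<close>).

  \<^item> The constants agree: \<open>m\<close> and \<open>v\<close> are the first derivative of the leading eigenvalue at \<open>-1\<close> and the
    second derivative minus the square of the first (\<open>limit_variance_eq\<close>). All increments vanish only
    if all transition probabilities are \<open>1/2\<close>, which gives \<open>\<sigma>\<^sup>2 > 0\<close> (\<open>var_rate_pos\<close>).

  \<^item> Strings are infinite, but two of them share a prefix of length \<open>k\<close> with probability exponentially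
    small in \<open>k\<close>. So \<open>L\<close> differs in mean by at most \<open>1\<close> from the contribution of the root and the
    next \<open>K\<close> levels if \<open>K\<close> is large (\<open>path_length_truncation\<close>), and that contribution is a function
    of independent words of length \<open>K + 1\<close>, i.e. lives on a finite product space
    (\<open>words_transfer\<close>).

  The proof ends with Levy's continuity theorem, because characteristic functions are Lipschitz with
  respect to the \<open>L\<^sup>1\<close> distance.
\<close>

section \<open>The Efron-Stein inequality for finite product distributions\<close>

lemma finite_set_Pi_pmf:
  assumes "finite A" "\<And>x. x \<in> A \<Longrightarrow> finite (set_pmf (p x))"
  shows "finite (set_pmf (Pi_pmf A d p))"
  using assms by (subst set_Pi_pmf) auto

lemma expectation_pair_pmf_finite:
  fixes h :: "'a \<times> 'b \<Rightarrow> real"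
  assumes "finite (set_pmf P)" "finite (set_pmf Q)"
  shows "measure_pmf.expectation (pair_pmf P Q) h
       = measure_pmf.expectation Q (\<lambda>f. measure_pmf.expectation P (\<lambda>y. h (y, f)))"
proof -
  have "measure_pmf.expectation (pair_pmf P Q) h
      = (\<Sum>(y,f) \<in> set_pmf P \<times> set_pmf Q. h (y, f) * (pmf P y * pmf Q f))"
    using assms by (subst integral_measure_pmf_real[of "set_pmf P \<times> set_pmf Q"])
      (auto simp: pmf_pair case_prod_unfold intro!: sum.cong)
  also have "\<dots> = (\<Sum>f\<in>set_pmf Q. \<Sum>y\<in>set_pmf P. h (y, f) * (pmf P y * pmf Q f))"
    by (subst sum.cartesian_product[symmetric]) (rule sum.swap)
  also have "\<dots> = (\<Sum>f\<in>set_pmf Q. (\<Sum>y\<in>set_pmf P. h (y, f) * pmf P y) * pmf Q f)"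
    by (simp add: sum_distrib_right mult.assoc)
  also have "\<dots> = measure_pmf.expectation Q (\<lambda>f. measure_pmf.expectation P (\<lambda>y. h (y, f)))"
    using assms by (simp add: integral_measure_pmf_real[of "set_pmf Q"] integral_measure_pmf_real[of "set_pmf P"])
  finally show ?thesis .
qed

lemma pmf_variance_le:
  fixes h :: "'a \<Rightarrow> real"
  assumes "finite (set_pmf P)"
  shows "measure_pmf.variance P h \<le> measure_pmf.expectation P (\<lambda>y. (h y - c)\<^sup>2)"
proof -
  note [simp] = integrable_measure_pmf_finite[OF assms]
  have "measure_pmf.expectation P (\<lambda>y. (h y - c)\<^sup>2)
      = measure_pmf.expectation P (\<lambda>y. (h y - measure_pmf.expectation P h)\<^sup>2
           + 2 * (measure_pmf.expectation P h - c) * (h y - measure_pmf.expectation P h)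
           + (measure_pmf.expectation P h - c)\<^sup>2)"
    by (rule arg_cong[where f="measure_pmf.expectation P"]) (auto simp: power2_eq_square algebra_simps)
  also have "\<dots> = measure_pmf.variance P h + (measure_pmf.expectation P h - c)\<^sup>2"
    by (simp add: measure_pmf.prob_space)
  finally show ?thesis by simp
qed

lemma pmf_square_expectation_le:
  fixes h :: "'a \<Rightarrow> real"
  assumes "finite (set_pmf P)"
  shows "(measure_pmf.expectation P h)\<^sup>2 \<le> measure_pmf.expectation P (\<lambda>y. (h y)\<^sup>2)"
proof -
  have "0 \<le> measure_pmf.variance P h" by (rule measure_pmf.variance_positive)
  also have "\<dots> = measure_pmf.expectation P (\<lambda>y. (h y)\<^sup>2) - (measure_pmf.expectation P h)\<^sup>2"
    by (rule measure_pmf.variance_eq) (auto intro: integrable_measure_pmf_finite[OF assms])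
  finally show ?thesis by simp
qed

lemma pmf_expectation_mono:
  fixes h :: "'a \<Rightarrow> real"
  assumes "finite (set_pmf P)" "\<And>y. y \<in> set_pmf P \<Longrightarrow> h y \<le> k y"
  shows "measure_pmf.expectation P h \<le> measure_pmf.expectation P k"
  using assms by (intro integral_mono_AE integrable_measure_pmf_finite) (auto simp: AE_measure_pmf_iff)

text \<open>
  The approximations \<open>G i\<close> are arbitrary functions that ignore coordinate \<open>i\<close>; they need not be
  conditional expectations, and for tries the natural choice is the same quantity without string \<open>i\<close>.
  When a coordinate \<open>x\<close> is added, the variance splits into the mean variance in coordinate \<open>x\<close>, which
  only grows if the centre is replaced by \<open>G x\<close>, and the variance of the average over coordinate \<open>x\<close>.
  The induction hypothesis applies to the latter, and Jensen's inequality takes the average out of the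
  squares.
\<close>
theorem efron_stein_Pi_pmf:
  fixes F :: "('a \<Rightarrow> 'b) \<Rightarrow> real"
  assumes "finite A" and P: "finite (set_pmf P)"
    and "\<And>i f y. i \<in> A \<Longrightarrow> G i (f(i := y)) = G i f"
  shows "measure_pmf.variance (Pi_pmf A d (\<lambda>_. P)) F
       \<le> (\<Sum>i\<in>A. measure_pmf.expectation (Pi_pmf A d (\<lambda>_. P)) (\<lambda>f. (F f - G i f)\<^sup>2))"
  using assms(1,3)
proof (induction A arbitrary: F G rule: finite_induct)
  case empty
  then show ?case by simp
next
  case (insert x A)
  define Q where "Q = Pi_pmf A d (\<lambda>_. P)"
  have Q: "finite (set_pmf Q)"
    unfolding Q_def by (rule finite_set_Pi_pmf) (use insert P in auto)
  note [simp] = integrable_measure_pmf_finite[OF Q] integrable_measure_pmf_finite[OF P]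
  define EP where "EP = (\<lambda>h::'b \<Rightarrow> real. measure_pmf.expectation P h)"
  define EQ where "EQ = (\<lambda>h::('a \<Rightarrow> 'b) \<Rightarrow> real. measure_pmf.expectation Q h)"
  have E: "measure_pmf.expectation (Pi_pmf (insert x A) d (\<lambda>_. P)) h = EQ (\<lambda>f. EP (\<lambda>y. h (f(x := y))))"
    for h :: "('a \<Rightarrow> 'b) \<Rightarrow> real"
    unfolding EQ_def EP_def using insert(1,2)
    by (subst Pi_pmf_insert) (simp_all add: Q_def[symmetric] expectation_pair_pmf_finite P Q case_prod_unfold)
  define e where "e = EQ (\<lambda>f. EP (\<lambda>y. F (f(x := y))))"
  define F' where "F' = (\<lambda>f. EP (\<lambda>y. F (f(x := y))))"
  define G' where "G' = (\<lambda>i f. EP (\<lambda>y. G i (f(x := y))))"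
  have e: "e = EQ F'" by (simp add: e_def F'_def)
  have split: "EP (\<lambda>y. (F (f(x := y)) - e)\<^sup>2) = EP (\<lambda>y. (F (f(x := y)) - F' f)\<^sup>2) + (F' f - e)\<^sup>2" for f
  proof -
    have "EP (\<lambda>y. (F (f(x := y)) - e)\<^sup>2) = EP (\<lambda>y. (F (f(x := y)) - F' f)\<^sup>2
             + 2 * (F' f - e) * (F (f(x := y)) - F' f) + (F' f - e)\<^sup>2)"
      by (rule arg_cong[where f=EP]) (auto simp: power2_eq_square algebra_simps)
    also have "\<dots> = EP (\<lambda>y. (F (f(x := y)) - F' f)\<^sup>2) + 2 * (F' f - e) * (EP (\<lambda>y. F (f(x := y))) - F' f) + (F' f - e)\<^sup>2"
      unfolding EP_def by (simp add: measure_pmf.prob_space)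
    finally show ?thesis by (simp add: F'_def)
  qed
  have "measure_pmf.variance (Pi_pmf (insert x A) d (\<lambda>_. P)) F = EQ (\<lambda>f. EP (\<lambda>y. (F (f(x := y)) - e)\<^sup>2))"
    unfolding E e_def by simp
  also have "\<dots> = EQ (\<lambda>f. EP (\<lambda>y. (F (f(x := y)) - F' f)\<^sup>2)) + EQ (\<lambda>f. (F' f - e)\<^sup>2)"
    unfolding split by (simp add: EQ_def)
  also have "EQ (\<lambda>f. EP (\<lambda>y. (F (f(x := y)) - F' f)\<^sup>2)) \<le> EQ (\<lambda>f. EP (\<lambda>y. (F (f(x := y)) - G x (f(x := y)))\<^sup>2))"
    unfolding EQ_def
  proof (rule pmf_expectation_mono[OF Q])
    fix f
    have "EP (\<lambda>y. (F (f(x := y)) - F' f)\<^sup>2) \<le> EP (\<lambda>y. (F (f(x := y)) - G x f)\<^sup>2)"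
      unfolding F'_def EP_def by (rule pmf_variance_le[OF P])
    then show "EP (\<lambda>y. (F (f(x := y)) - F' f)\<^sup>2) \<le> EP (\<lambda>y. (F (f(x := y)) - G x (f(x := y)))\<^sup>2)"
      by (simp only: insert.prems[of x, OF insertI1])
  qed
  also have "EQ (\<lambda>f. (F' f - e)\<^sup>2) \<le> (\<Sum>i\<in>A. EQ (\<lambda>f. (F' f - G' i f)\<^sup>2))"
    unfolding EQ_def Q_def e[unfolded EQ_def Q_def]
  proof (rule insert.IH)
    fix i and f :: "'a \<Rightarrow> 'b" and y assume "i \<in> A"
    then have "i \<noteq> x" using insert by auto
    then have "f(i := y, x := z) = f(x := z, i := y)" for z by (rule fun_upd_twist)
    then show "G' i (f(i := y)) = G' i f"
      unfolding G'_def by (simp only: insert.prems[of i, OF insertI2[OF \<open>i \<in> A\<close>]])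
  qed
  also have "(\<Sum>i\<in>A. EQ (\<lambda>f. (F' f - G' i f)\<^sup>2)) \<le> (\<Sum>i\<in>A. EQ (\<lambda>f. EP (\<lambda>y. (F (f(x := y)) - G i (f(x := y)))\<^sup>2)))"
  proof (rule sum_mono)
    fix i
    show "EQ (\<lambda>f. (F' f - G' i f)\<^sup>2) \<le> EQ (\<lambda>f. EP (\<lambda>y. (F (f(x := y)) - G i (f(x := y)))\<^sup>2))"
      unfolding EQ_def
    proof (rule pmf_expectation_mono[OF Q])
      fix f
      have eq: "F' f - G' i f = EP (\<lambda>y. F (f(x := y)) - G i (f(x := y)))"
        by (simp add: F'_def G'_def EP_def)
      show "(F' f - G' i f)\<^sup>2 \<le> EP (\<lambda>y. (F (f(x := y)) - G i (f(x := y)))\<^sup>2)"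
        unfolding eq EP_def by (rule pmf_square_expectation_le[OF P])
    qed
  qed
  finally show ?case
    unfolding E sum.insert[OF insert(1,2)] e_def[unfolded F'_def] by (simp add: fun_upd_def)
qed

section \<open>One level of a trie, and sums along a path\<close>

text \<open>The other strings of \<open>J\<close> that pass through the node at depth \<open>k\<close> on the path of string \<open>i\<close>.\<close>
definition meets :: "nat \<Rightarrow> (nat \<Rightarrow> 'a list) \<Rightarrow> nat set \<Rightarrow> nat \<Rightarrow> nat set" where
  "meets k f J i = {l \<in> J - {i}. take k (f l) = take k (f i)}"

text \<open>
  The contribution of depth \<open>k\<close> to the external path length: a string is stored below depth \<open>k\<close> exactly
  if its node at depth \<open>k\<close> is shared.
\<close>
definition level_count :: "nat \<Rightarrow> (nat \<Rightarrow> 'a list) \<Rightarrow> nat set \<Rightarrow> nat" where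
  "level_count k f J = card {j \<in> J. meets k f J j \<noteq> {}}"

text \<open>
  Together with string \<open>i\<close> itself, a string \<open>j\<close> leaves the level only if \<open>i\<close> was its sole companion.
  Two such strings would be companions of each other, so there is at most one, and there is none if \<open>i\<close>
  has at least two companions.
\<close>
lemma level_count_remove:
  fixes f :: "nat \<Rightarrow> 'a list" and k :: nat
  assumes J: "finite J" and i: "i \<in> J"
  defines "N \<equiv> card (meets k f J i)"
  defines "d \<equiv> real (level_count k f J) - real (level_count k f (J - {i}))"
  shows "0 \<le> d" "d \<le> 2" "N = 0 \<Longrightarrow> d = 0" "2 \<le> N \<Longrightarrow> d = 1"
proof -
  let ?M = "meets k f J i"
  let ?S = "{j \<in> J. meets k f J j \<noteq> {}}"
  let ?S' = "{j \<in> J - {i}. meets k f (J - {i}) j \<noteq> {}}"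
  \<comment> \<open>the other strings that leave the level, having \<open>i\<close> as their only companion\<close>
  let ?R = "{j \<in> ?M. meets k f (J - {i}) j = {}}"
  have fin: "finite ?S" "finite ?S'" "finite ?M" "finite ?R"
  proof -
    show "finite ?S" using J by simp
    show "finite ?S'" by (rule finite_subset[OF _ J]) auto
    show "finite ?M" using J by (simp add: meets_def)
    then show "finite ?R" by simp
  qed
  have S: "?S = ?S' \<union> (?R \<union> {j \<in> {i}. ?M \<noteq> {}})"
    using i by (auto simp: meets_def)
  have card: "card ?S = card ?S' + (card ?R + of_bool (?M \<noteq> {}))"
  proof -
    have "?S' \<inter> (?R \<union> {j \<in> {i}. ?M \<noteq> {}}) = {}" "?R \<inter> {j \<in> {i}. ?M \<noteq> {}} = {}"
      by (auto simp: meets_def)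
    then have "card ?S = card ?S' + (card ?R + card {j \<in> {i}. ?M \<noteq> {}})"
      unfolding S using fin by (subst card_Un_disjoint; (simp only: finite_Un)?; (subst card_Un_disjoint)?) simp_all
    then show ?thesis by simp
  qed
  have d: "d = real (card ?R) + of_bool (?M \<noteq> {})"
    unfolding d_def level_count_def card by simp
  have R: "?R \<subseteq> {j}" if "j \<in> ?R" for j
    using that by (auto simp: meets_def)
  have R1: "card ?R \<le> 1"
  proof (cases "?R = {}")
    case False
    then obtain j where "j \<in> ?R" by blast
    from card_mono[OF _ R[OF this]] show ?thesis by simp
  qed (simp only: card.empty)
  show "0 \<le> d" "d \<le> 2" using R1 by (auto simp: d)
  show "d = 0" if "N = 0"
  proof -
    have "?M = {}" using that fin by (simp add: N_def)
    then show ?thesis by (simp add: d)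
  qed
  show "d = 1" if "2 \<le> N"
  proof -
    have "?M \<noteq> {}" using that by (auto simp: N_def)
    moreover have R0: "?R = {}"
    proof (rule ccontr)
      assume "?R \<noteq> {}"
      then obtain j where j: "j \<in> ?R" by blast
      then have "?M \<subseteq> {j}" by (auto simp: meets_def)
      from card_mono[OF _ this] show False using that by (simp add: N_def)
    qed
    ultimately show ?thesis unfolding d R0 by simp
  qed
qed

text \<open>
  The two bounds serve the two ends of a path. Near the root many companions are expected, the string
  should cost exactly \<open>1\<close>, and an error requires \<open>N \<le> 1\<close>; \<open>(1/2) ^ N\<close> is used since its expectation
  factorises over the strings. Far from the root no companion is expected, and the linear bound turns
  into a union bound.
\<close>
lemma level_count_remove_square:
  fixes f :: "nat \<Rightarrow> 'a list" and k :: nat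
  assumes J: "finite J" and i: "i \<in> J"
  defines "N \<equiv> card (meets k f J i)"
  defines "d \<equiv> real (level_count k f J) - real (level_count k f (J - {i}))"
  shows "(d - 1)\<^sup>2 \<le> 2 * (1/2) ^ N" "d\<^sup>2 \<le> 4 * real N"
proof -
  note * = level_count_remove[OF assms(1,2), of k f, folded N_def d_def]
  show "d\<^sup>2 \<le> 4 * real N"
  proof (cases "N = 0")
    case False
    have "d\<^sup>2 \<le> 2\<^sup>2" by (rule power_mono) (use * in auto)
    then show ?thesis using False by simp
  qed (use * in simp)
  consider "N = 0 \<or> N = 1" | "2 \<le> N" by linarith
  then show "(d - 1)\<^sup>2 \<le> 2 * (1/2) ^ N"
  proof cases
    case 1
    have "\<bar>d - 1\<bar> \<le> 1" using *(1,2) by (simp add: abs_le_iff)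
    then have "(d - 1)\<^sup>2 \<le> 1" by (simp add: abs_square_le_1)
    with 1 show ?thesis by auto
  qed (use * in simp)
qed

lemma sum_below_1_le:
  fixes s :: "nat \<Rightarrow> real"
  assumes r: "0 < r" "r < 1" 
    and s: "\<And>k. k < K \<Longrightarrow> 0 < s k" "\<And>k. Suc k < K \<Longrightarrow> s (Suc k) \<le> r * s k"
  shows "(\<Sum>k<K. if s k \<le> 1 then s k else 0) \<le> min 1 (if K = 0 then 1 else s 0) / (1 - r)"
  using s
proof (induction K arbitrary: s)
  case (Suc K)
  have IH: "(\<Sum>k<K. if s (Suc k) \<le> 1 then s (Suc k) else 0) \<le> min 1 (if K = 0 then 1 else s 1) / (1 - r)"
    using Suc.IH[of "\<lambda>k. s (Suc k)"] Suc.prems r by auto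
  have s0: "0 < s 0" using Suc.prems by simp
  have "(\<Sum>k<K. if s (Suc k) \<le> 1 then s (Suc k) else 0) \<le> min 1 (r * s 0) / (1 - r)"
  proof (cases "K = 0")
    case False
    have "min 1 (s 1) \<le> min 1 (r * s 0)" using Suc.prems(2)[of 0] False by simp
    then have "min 1 (s 1) / (1-r) \<le> min 1 (r * s 0) / (1 - r)" using r by (simp add: divide_right_mono)
    then show ?thesis using IH False by simp
  qed (use r s0 in simp)
  moreover have "(if s 0 \<le> 1 then s 0 else 0) + min 1 (r * s 0) / (1 - r) \<le> min 1 (s 0) / (1 - r)"
  proof (cases "s 0 \<le> 1")
    case True
    have "r * s 0 \<le> 1 * 1" by (rule mult_mono) (use True r s0 in auto)
    then show ?thesis using True r by (simp add: field_simps)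
  next
    case False
    then show ?thesis using r by (simp add: divide_right_mono)
  qed
  ultimately show ?case by (simp add: sum.lessThan_Suc_shift del: sum.lessThan_Suc)
qed (use r in simp)

lemma sum_inverse_above_1_le:
  fixes s :: "nat \<Rightarrow> real"
  assumes r: "0 < r" "r < 1" 
    and s: "\<And>k. k \<le> K \<Longrightarrow> 0 < s k" "\<And>k. k < K \<Longrightarrow> s (Suc k) \<le> r * s k"
  shows "(\<Sum>k\<le>K. if s k \<le> 1 then 0 else 1 / s k) \<le> min 1 (1 / s K) / (1 - r)"
  using s
proof (induction K)
  case 0
  then show ?case using r by (auto simp: min_def field_simps)
next
  case (Suc K)
  define t where "t = s (Suc K)"
  have t: "0 < t" "t \<le> r * s K" "0 < s K" using Suc.prems by (auto simp: t_def)
  have IH: "(\<Sum>k\<le>K. if s k \<le> 1 then 0 else 1 / s k) \<le> min 1 (1 / s K) / (1 - r)"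
    using Suc by simp
  have "1 / s K \<le> r / t" using t by (simp add: field_simps)
  then have "min 1 (1 / s K) \<le> min 1 (r / t)" by auto
  then have "min 1 (1 / s K) / (1 - r) \<le> min 1 (r / t) / (1 - r)" using r by (simp add: divide_right_mono)
  moreover have "min 1 (r / t) / (1 - r) + (if t \<le> 1 then 0 else 1 / t) \<le> min 1 (1 / t) / (1 - r)"
  proof (cases "t \<le> 1")
    case True
    then have "min 1 (1/t) = 1" using t by (simp add: min_def field_simps)
    then show ?thesis using r True by (simp add: divide_right_mono)
  next
    case False
    then have "min 1 (1 / t) = 1 / t" "min 1 (r / t) = r / t" using r by (auto simp: min_def field_simps)
    then show ?thesis using False r t by (simp add: field_simps)
  qed
  ultimately show ?case using IH unfolding sum.atMost_Suc t_def[symmetric] by linarith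
qed

text \<open>
  A sequence with \<open>s (Suc k) \<le> r * s k\<close> crosses the value \<open>1\<close> at most once, and \<open>min s (1/s)\<close> is
  dominated by a geometric series on either side of the crossing. The point is that the bound depends
  neither on the starting value nor on the length.
\<close>
lemma sum_min_inverse_le:
  fixes s :: "nat \<Rightarrow> real"
  assumes r: "0 < r" "r < 1" 
    and s: "\<And>k. k < K \<Longrightarrow> 0 < s k" "\<And>k. Suc k < K \<Longrightarrow> s (Suc k) \<le> r * s k"
  shows "(\<Sum>k<K. if s k \<le> 1 then s k else 1 / s k) \<le> 2 / (1 - r)"
proof (cases K)
  case (Suc K')
  have "(\<Sum>k<K. if s k \<le> 1 then s k else 0) \<le> min 1 (if K = 0 then 1 else s 0) / (1 - r)"
    by (rule sum_below_1_le) (use assms in auto)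
  also have "\<dots> \<le> 1 / (1 - r)" using r by (intro divide_right_mono) auto
  finally have 1: "(\<Sum>k<K. if s k \<le> 1 then s k else 0) \<le> 1 / (1 - r)" .
  have "(\<Sum>k<K. if s k \<le> 1 then 0 else 1 / s k) \<le> min 1 (1 / s K') / (1 - r)"
    unfolding Suc lessThan_Suc_atMost by (rule sum_inverse_above_1_le) (use assms Suc in auto)
  also have "\<dots> \<le> 1 / (1 - r)" using r by (intro divide_right_mono) auto
  finally have 2: "(\<Sum>k<K. if s k \<le> 1 then 0 else 1 / s k) \<le> 1 / (1 - r)" .
  have "(\<Sum>k<K. if s k \<le> 1 then s k else 1 / s k)
      = (\<Sum>k<K. if s k \<le> 1 then s k else 0) + (\<Sum>k<K. if s k \<le> 1 then 0 else 1 / s k)"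
    unfolding sum.distrib[symmetric] by (rule sum.cong) auto
  then show ?thesis using 1 2 by simp
qed (use r in simp)

text \<open>
  The Cauchy-Schwarz inequality with weights \<open>\<theta>\<close>: if \<open>(d k)\<^sup>2\<close> has expectation of order \<open>(\<theta> k)\<^sup>2\<close>, the
  right-hand side has expectation of order \<open>(\<Sum>k. \<theta> k)\<^sup>2\<close>.
\<close>
lemma square_sum_le_weighted:
  fixes d \<theta> :: "nat \<Rightarrow> real"
  assumes "\<And>k. k < K \<Longrightarrow> 0 < \<theta> k"
  shows "(\<Sum>k<K. d k)\<^sup>2 \<le> (\<Sum>k<K. \<theta> k) * (\<Sum>k<K. (d k)\<^sup>2 / \<theta> k)"
proof -
  have "(\<Sum>k<K. d k)\<^sup>2 = (\<Sum>k<K. sqrt (\<theta> k) * (d k / sqrt (\<theta> k)))\<^sup>2"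
    using assms by (intro arg_cong[where f="\<lambda>x. x\<^sup>2"] sum.cong) (auto simp: less_imp_neq[symmetric] dest!: assms)
  also have "\<dots> \<le> (\<Sum>k<K. (sqrt (\<theta> k))\<^sup>2) * (\<Sum>k<K. (d k / sqrt (\<theta> k))\<^sup>2)"
    by (rule Cauchy_Schwarz_ineq_sum)
  also have "\<dots> = (\<Sum>k<K. \<theta> k) * (\<Sum>k<K. (d k)\<^sup>2 / \<theta> k)"
    using assms by (intro arg_cong2[where f="(*)"] sum.cong) (auto simp: power_divide less_imp_le)
  finally show ?thesis .
qed

section \<open>The two-state chain and its leading eigenvalue\<close>

lemma det_dim_2:
  assumes A: "A \<in> carrier_mat 2 2"
  shows "det A = A $$ (0,0) * A $$ (1,1) - A $$ (0,1) * A $$ (1,0)"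
proof -
  have "det A = (\<Sum>i<2. A $$ (i,0) * cofactor A i 0)"
    using laplace_expansion_column[OF A, of 0] by simp
  also have "\<dots> = A $$ (0,0) * det (mat_delete A 0 0) - A $$ (1,0) * det (mat_delete A 1 0)"
    by (simp add: cofactor_def numeral_2_eq_2)
  also have "det (mat_delete A 0 0) = A $$ (1,1)"
    using A by (subst det_single) (auto simp: mat_delete_def)
  also have "det (mat_delete A 1 0) = A $$ (0,1)"
    using A by (subst det_single) (auto simp: mat_delete_def)
  finally show ?thesis by (simp add: mult.commute)
qed

locale binary_chain =
  fixes p :: "bool \<Rightarrow> bool \<Rightarrow> real"
  assumes p_pos: "0 < p i j" and p_less_1: "p i j < 1"
    and p_row: "p i False + p i True = 1"
begin

definition step_mean :: "bool \<Rightarrow> (bool \<Rightarrow> real) \<Rightarrow> real" where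
  "step_mean i f = p i False * f False + p i True * f True"

definition stationary_mean :: "(bool \<Rightarrow> real) \<Rightarrow> real" where
  "stationary_mean f = (p True False * f False + p False True * f True) / (p False True + p True False)"

text \<open>The solution of the Poisson equation for \<open>f\<close> that vanishes in state \<open>False\<close>.\<close>
definition corrector :: "(bool \<Rightarrow> real) \<Rightarrow> bool \<Rightarrow> real" where
  "corrector f i = (if i then (f True - f False) / (p False True + p True False) else 0)"

lemma p_False: "p i False = 1 - p i True"
  using p_row[of i] by simp

lemma switch_pos: "0 < p False True + p True False"
  using p_pos[of False True] p_pos[of True False] by simp

lemma poisson_equation:
  "f i + step_mean i (corrector f) - corrector f i = stationary_mean f"
proof -
  have *: "p False True + p True False \<noteq> 0" using switch_pos by simp
  have "p False False = 1 - p False True" "p True True = 1 - p True False"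
    using p_row[of False] p_row[of True] by auto
  then show ?thesis
    using * by (cases i) (simp_all add: step_mean_def stationary_mean_def corrector_def divide_simps, simp_all add: algebra_simps)
qed

definition info :: "bool \<Rightarrow> bool \<Rightarrow> real" where
  "info i j = - ln (p i j)"

definition step_entropy :: "bool \<Rightarrow> real" where
  "step_entropy i = step_mean i (info i)"

definition rate :: real where
  "rate = stationary_mean step_entropy"

text \<open>
  The corrector of the entropy removes the dependence of the expected information on the present
  state, so that \<open>incr i\<close> has mean zero under the transition from every \<open>i\<close>: these are the increments
  of a martingale that stays within bounded distance of the centred information.
\<close>
definition incr :: "bool \<Rightarrow> bool \<Rightarrow> real" where
  "incr i j = info i j - rate + corrector step_entropy j - corrector step_entropy i"

definition incr_var :: "bool \<Rightarrow> real" where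
  "incr_var i = step_mean i (\<lambda>j. (incr i j)\<^sup>2)"

definition var_rate :: real where
  "var_rate = stationary_mean incr_var"

lemma info_pos: "0 < info i j"
  using p_pos[of i j] p_less_1[of i j] by (simp add: info_def)

lemma rate_pos: "0 < rate"
  using switch_pos p_pos info_pos
  by (auto simp: rate_def stationary_mean_def step_entropy_def step_mean_def intro!: divide_pos_pos add_pos_pos mult_pos_pos)

lemma step_mean_incr: "step_mean i (incr i) = 0"
proof -
  have "step_mean i (incr i) = step_entropy i + step_mean i (corrector step_entropy) - (p i False + p i True) * (rate + corrector step_entropy i)"
    by (simp add: step_mean_def incr_def step_entropy_def algebra_simps)
  then show ?thesis using poisson_equation[of step_entropy i] by (simp add: p_row rate_def)
qed

text \<open>
  If all increments vanish, the two loops give \<open>- ln (p False False) = - ln (p True True) = rate\<close>, and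
  on the cycle through both states the corrector cancels, so that
  \<open>p False True * p True False = p False False * p True True\<close>. With rows summing to \<open>1\<close> this forces
  all probabilities to be \<open>1/2\<close>.
\<close>
lemma var_rate_pos:
  assumes "\<exists>i j. p i j \<noteq> 1/2"
  shows "0 < var_rate"
proof (rule ccontr)
  assume "\<not> 0 < var_rate"
  then have "p True False * incr_var False + p False True * incr_var True \<le> 0"
    using switch_pos by (simp add: var_rate_def stationary_mean_def zero_less_divide_iff not_less)
  moreover have nn: "0 \<le> incr_var i" for i
    using p_pos[of i] by (simp add: incr_var_def step_mean_def less_imp_le)
  moreover have "0 \<le> p True False * incr_var False" "0 \<le> p False True * incr_var True"
    using p_pos nn by (simp_all add: less_imp_le)
  ultimately have "p True False * incr_var False = 0" "p False True * incr_var True = 0"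
    by linarith+
  then have z0: "incr_var i = 0" for i
    using p_pos[of True False] p_pos[of False True] by (cases i) auto
  have "p i False * (incr i False)\<^sup>2 = 0 \<and> p i True * (incr i True)\<^sup>2 = 0" for i
  proof -
    have "0 \<le> p i False * (incr i False)\<^sup>2" "0 \<le> p i True * (incr i True)\<^sup>2"
      using p_pos by (simp_all add: less_imp_le)
    with z0[of i] show ?thesis unfolding incr_var_def step_mean_def by linarith
  qed
  note terms_0 = this
  have z: "incr i j = 0" for i j
  proof -
    have "p i j \<noteq> 0" using p_pos[of i j] by simp
    then show ?thesis using terms_0[of i] by (cases j) simp_all
  qed
  have 1: "info False False = rate" "info True True = rate" "info False True + info True False = 2 * rate"
    using z[of False False] z[of True True] z[of False True] z[of True False] by (auto simp: incr_def)
  then have "ln (p False False) = ln (p True True)" by (simp add: info_def)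
  then have eq: "p False False = p True True" using p_pos by simp
  have "ln (p False True * p True False) = ln (p False False * p True True)"
    using 1 p_pos by (subst (1 2) ln_mult) (auto simp: info_def less_imp_neq[symmetric])
  then have "p False True * p True False = p False False * p True True"
    using p_pos by simp
  moreover have "p False True = 1 - p True True" "p True False = 1 - p True True"
    using eq p_row[of False] p_row[of True] by auto
  ultimately have "p True True = 1/2" using eq by (simp add: algebra_simps)
  then have "p i j = 1/2" for i j
    using eq p_row[of False] p_row[of True] by (cases i; cases j) auto
  then show False using assms by blast
qed

lemma eigenvalue_P_mat:
  "eigenvalue (P_mat p s) x \<longleftrightarrow>
    (x - p False False powr (-s)) * (x - p True True powr (-s)) - p False True powr (-s) * p True False powr (-s) = 0"
proof -
  have P: "P_mat p s \<in> carrier_mat 2 2" by (simp add: P_mat_def)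
  have "eigenvalue (P_mat p s) x \<longleftrightarrow> poly (char_poly (P_mat p s)) x = 0"
    by (rule eigenvalue_root_char_poly[OF P])
  also have "poly (char_poly (P_mat p s)) x =
    (x - p False False powr (-s)) * (x - p True True powr (-s)) - p False True powr (-s) * p True False powr (-s)"
    unfolding char_poly_def
    by (subst det_dim_2[of "char_poly_matrix (P_mat p s)"]) (simp_all add: char_poly_matrix_def P_mat_def algebra_simps)
  finally show ?thesis by simp
qed

text \<open>The discriminant of the characteristic polynomial of \<open>P_mat p s\<close>.\<close>
definition disc :: "real \<Rightarrow> real" where
  "disc s = (exp (s * info False False) - exp (s * info True True))\<^sup>2
     + 4 * exp (s * (info False True + info True False))"

lemma disc_pos: "0 < disc s"
  by (auto simp: disc_def intro!: add_nonneg_pos)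

lemma lead_eigenvalue_eq:
  "lead_eigenvalue p s = (exp (s * info False False) + exp (s * info True True) + sqrt (disc s)) / 2"
proof -
  define a d where "a = exp (s * info False False)" and "d = exp (s * info True True)"
  define bc where "bc = exp (s * (info False True + info True False))"
  have bc: "exp (s * info False True) * exp (s * info True False) = bc"
    unfolding bc_def distrib_left exp_add ..
  have pw: "p i j powr (-s) = exp (s * info i j)" for i j
    using p_pos[of i j] by (simp add: powr_def info_def)
  have D: "disc s = (a - d)\<^sup>2 + 4 * bc" by (simp add: disc_def a_def d_def bc_def)
  have sq: "sqrt (disc s) * sqrt (disc s) = (a - d)\<^sup>2 + 4 * bc" "0 < sqrt (disc s)"
    using disc_pos[of s] by (simp_all add: D[symmetric])
  have ev: "eigenvalue (P_mat p s) x \<longleftrightarrow> x = (a + d + sqrt (disc s)) / 2 \<or> x = (a + d - sqrt (disc s)) / 2" for x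
  proof -
    have "eigenvalue (P_mat p s) x \<longleftrightarrow> (x - a) * (x - d) - bc = 0"
      unfolding eigenvalue_P_mat pw a_def[symmetric] d_def[symmetric] bc ..
    also have "(x - a) * (x - d) - bc = (x - (a + d + sqrt (disc s)) / 2) * (x - (a + d - sqrt (disc s)) / 2)"
    proof -
      have "(x - (a + d + R) / 2) * (x - (a + d - R) / 2) = x * x - (a + d) * x + ((a + d) * (a + d) - R * R) / 4" for R
        by (simp add: field_simps)
      from this[of "sqrt (disc s)"] show ?thesis
        unfolding sq(1) by (simp add: field_simps power2_eq_square)
    qed
    also have "\<dots> = 0 \<longleftrightarrow> x = (a + d + sqrt (disc s)) / 2 \<or> x = (a + d - sqrt (disc s)) / 2"
      by simp
    finally show ?thesis .
  qed
  have "{x. eigenvalue (P_mat p s) x} = {(a + d + sqrt (disc s)) / 2, (a + d - sqrt (disc s)) / 2}"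
    by (simp only: ev) auto
  then have "lead_eigenvalue p s = max ((a + d + sqrt (disc s)) / 2) ((a + d - sqrt (disc s)) / 2)"
    unfolding lead_eigenvalue_def by simp
  also have "\<dots> = (a + d + sqrt (disc s)) / 2"
    using sq(2) by (simp only: max_def) simp
  finally show ?thesis unfolding a_def d_def .
qed

text \<open>First and second derivative of the discriminant.\<close>
definition disc1 :: "real \<Rightarrow> real" where
  "disc1 s = 2 * (exp (s * info False False) - exp (s * info True True))
       * (info False False * exp (s * info False False) - info True True * exp (s * info True True))
     + 4 * (info False True + info True False) * exp (s * (info False True + info True False))"

definition disc2 :: "real \<Rightarrow> real" where
  "disc2 s = 2 * (info False False * exp (s * info False False) - info True True * exp (s * info True True))\<^sup>2
     + 2 * (exp (s * info False False) - exp (s * info True True))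
       * ((info False False)\<^sup>2 * exp (s * info False False) - (info True True)\<^sup>2 * exp (s * info True True))
     + 4 * (info False True + info True False)\<^sup>2 * exp (s * (info False True + info True False))"

lemma DERIV_exp_scale: "((\<lambda>s. exp (s * c)) has_real_derivative c * exp (s * c)) (at s)" for c s :: real
  by (auto intro!: derivative_eq_intros)

lemma DERIV_disc: "(disc has_real_derivative disc1 s) (at s)"
proof -
  have 1: "((\<lambda>s. exp (s * info False False) - exp (s * info True True)) has_real_derivative
      info False False * exp (s * info False False) - info True True * exp (s * info True True)) (at s)"
    by (intro DERIV_diff DERIV_exp_scale)
  have 2: "((\<lambda>s. 4 * exp (s * (info False True + info True False))) has_real_derivative
      4 * ((info False True + info True False) * exp (s * (info False True + info True False)))) (at s)"
    by (intro DERIV_cmult DERIV_exp_scale)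
  show ?thesis
    unfolding disc_def[abs_def] disc1_def
    by (rule DERIV_cong[OF DERIV_add[OF DERIV_power[OF 1, where n = 2] 2]]) (simp add: algebra_simps)
qed

lemma DERIV_disc1: "(disc1 has_real_derivative disc2 s) (at s)"
proof -
  have 1: "((\<lambda>s. 2 * (exp (s * info False False) - exp (s * info True True))) has_real_derivative
      2 * (info False False * exp (s * info False False) - info True True * exp (s * info True True))) (at s)"
    by (intro DERIV_cmult DERIV_diff DERIV_exp_scale)
  have 2: "((\<lambda>s. info False False * exp (s * info False False) - info True True * exp (s * info True True)) has_real_derivative
      info False False * (info False False * exp (s * info False False)) - info True True * (info True True * exp (s * info True True))) (at s)"
    by (intro DERIV_cmult DERIV_diff DERIV_exp_scale)
  have 3: "((\<lambda>s. 4 * (info False True + info True False) * exp (s * (info False True + info True False))) has_real_derivative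
      4 * (info False True + info True False) * ((info False True + info True False) * exp (s * (info False True + info True False)))) (at s)"
    by (intro DERIV_cmult DERIV_exp_scale)
  show ?thesis
    unfolding disc1_def[abs_def] disc2_def
    by (rule DERIV_cong[OF DERIV_add[OF DERIV_mult[OF 1 2] 3]]) (simp add: power2_eq_square algebra_simps)
qed

lemma DERIV_sqrt_disc: "((\<lambda>s. sqrt (disc s)) has_real_derivative disc1 s / (2 * sqrt (disc s))) (at s)"
  by (rule DERIV_cong[OF DERIV_chain2[OF DERIV_real_sqrt[OF disc_pos] DERIV_disc]])
    (simp add: inverse_eq_divide)

lemma deriv_lead_eigenvalue:
  "deriv (lead_eigenvalue p) s = (info False False * exp (s * info False False) + info True True * exp (s * info True True)
     + disc1 s / (2 * sqrt (disc s))) / 2"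
  unfolding lead_eigenvalue_eq[abs_def]
  by (intro DERIV_imp_deriv DERIV_cdivide DERIV_add DERIV_exp_scale DERIV_sqrt_disc)

lemma deriv2_lead_eigenvalue:
  "deriv (deriv (lead_eigenvalue p)) s =
    ((info False False)\<^sup>2 * exp (s * info False False) + (info True True)\<^sup>2 * exp (s * info True True)
     + (disc2 s / (2 * sqrt (disc s)) - (disc1 s)\<^sup>2 / (4 * (sqrt (disc s))^3))) / 2"
proof -
  define R where "R = sqrt (disc s)"
  have R: "R > 0" "disc s = R\<^sup>2" using disc_pos[of s] by (auto simp: R_def)
  have 1: "((\<lambda>s. disc1 s / (2 * sqrt (disc s))) has_real_derivative
      (disc2 s / (2 * sqrt (disc s)) - (disc1 s)\<^sup>2 / (4 * (sqrt (disc s))^3))) (at s)"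
  proof (rule DERIV_cong[OF DERIV_divide[OF DERIV_disc1 DERIV_cmult[OF DERIV_sqrt_disc]]])
    show "2 * sqrt (disc s) \<noteq> 0" using disc_pos[of s] by simp
    show "(disc2 s * (2 * sqrt (disc s)) - disc1 s * (2 * (disc1 s / (2 * sqrt (disc s))))) / (2 * sqrt (disc s) * (2 * sqrt (disc s)))
      = disc2 s / (2 * sqrt (disc s)) - (disc1 s)\<^sup>2 / (4 * (sqrt (disc s))^3)"
      unfolding R_def[symmetric] using R(1) by (simp add: field_simps power2_eq_square power3_eq_cube)
  qed
  have 2: "((\<lambda>s. info False False * exp (s * info False False) + info True True * exp (s * info True True))
      has_real_derivative ((info False False)\<^sup>2 * exp (s * info False False) + (info True True)\<^sup>2 * exp (s * info True True))) (at s)"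
    unfolding power2_eq_square mult.assoc by (intro DERIV_cmult DERIV_add DERIV_exp_scale)
  show ?thesis
    unfolding deriv_lead_eigenvalue[abs_def]
    by (rule DERIV_imp_deriv[OF DERIV_cdivide[OF DERIV_add[OF 2 1]]])
qed

text \<open>
  At \<open>-1\<close> the matrix is stochastic and its discriminant is the square of \<open>\<delta> = p False True + p True False\<close>,
  so both derivatives of the eigenvalue are rational in the transition probabilities and
  their logarithms. What remains is a
  polynomial identity modulo the definition of \<open>rate\<close> and the relations saying that \<open>incr\<close> has mean
  zero in both states.
\<close>
lemma limit_variance_eq: "limit_variance p = var_rate / rate ^ 3"
proof -
  define x y z w where xyzw: "x = info False False" "y = info False True" "z = info True False" "w = info True True"
  define a b c d where abcd: "a = p False False" "b = p False True" "c = p True False" "d = p True True"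
  define \<delta> where "\<delta> = b + c"
  have ab: "a = 1 - b" "d = 1 - c" using p_row[of False] p_row[of True] by (auto simp: abcd)
  have \<delta>: "0 < \<delta>" using switch_pos by (simp add: \<delta>_def abcd)
  have ex: "exp (- x) = a" "exp (- w) = d" "exp (- (y + z)) = b * c"
    using p_pos by (auto simp: abcd xyzw info_def exp_add exp_diff)
  have "disc (-1) = (a - d)\<^sup>2 + 4 * (b * c)"
    using ex by (simp add: disc_def xyzw[symmetric])
  also have "\<dots> = \<delta>\<^sup>2"
    by (simp add: ab \<delta>_def power2_eq_square algebra_simps)
  finally have "disc (-1) = \<delta>\<^sup>2" .
  then have D: "sqrt (disc (-1)) = \<delta>" using \<delta> by simp
  define m e where "m = rate" and "e = corrector step_entropy True"
  have m: "m * \<delta> = c * (a * x + b * y) + b * (c * z + d * w)"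
    using \<delta> by (simp add: m_def rate_def stationary_mean_def step_entropy_def step_mean_def xyzw[symmetric] abcd[symmetric] \<delta>_def)
  have d1: "disc1 (-1) = 2 * (a - d) * (x * a - w * d) + 4 * (y + z) * (b * c)"
    using ex by (simp add: disc1_def xyzw[symmetric])
  have d1': "disc1 (-1) = 2 * \<delta> * (2 * m - a * x - d * w)"
  proof -
    have "2 * \<delta> * (2 * m - a * x - d * w) = 4 * (m * \<delta>) - 2 * \<delta> * (a * x + d * w)"
      by (simp add: algebra_simps)
    then show ?thesis unfolding d1 m by (simp add: ab \<delta>_def algebra_simps)
  qed
  have l1: "deriv (lead_eigenvalue p) (-1) = m"
    using ex \<delta> unfolding deriv_lead_eigenvalue D d1' by (simp add: xyzw[symmetric] field_simps)
  have d2: "disc2 (-1) = 2 * (x * a - w * d)\<^sup>2 + 2 * (a - d) * (x\<^sup>2 * a - w\<^sup>2 * d) + 4 * (y + z)\<^sup>2 * (b * c)"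
    using ex by (simp add: disc2_def xyzw[symmetric])
  define l where "l = deriv (deriv (lead_eigenvalue p)) (-1)"
  have l: "2 * l * \<delta> = (x\<^sup>2 * a + w\<^sup>2 * d) * \<delta> + disc2 (-1) / 2 - (2 * m - a * x - d * w)\<^sup>2"
    using ex \<delta> unfolding l_def deriv2_lead_eigenvalue D d1' 
    by (simp add: xyzw[symmetric] field_simps power2_eq_square power3_eq_cube)
  have v: "var_rate * \<delta> = c * (a * (x - m)\<^sup>2 + b * (y - m + e)\<^sup>2) + b * (c * (z - m - e)\<^sup>2 + d * (w - m)\<^sup>2)"
  proof -
    have "corrector step_entropy False = 0" by (simp add: corrector_def)
    then show ?thesis using \<delta>
    by (simp add: var_rate_def stationary_mean_def incr_var_def step_mean_def incr_def xyzw[symmetric] abcd[symmetric]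
        \<delta>_def m_def[symmetric] e_def[symmetric])
  qed
  define u t \<alpha> \<beta> where "u = m - x" and "t = m - w" and "\<alpha> = y - m + e" and "\<beta> = z - m - e"
  have sub: "x = m - u" "w = m - t" "y = m + \<alpha> - e" "z = m + \<beta> + e"
    by (simp_all add: u_def t_def \<alpha>_def \<beta>_def)
  have c0: "corrector step_entropy False = 0" by (simp add: corrector_def)
  \<comment> \<open>\<open>- u\<close>, \<open>- t\<close>, \<open>\<alpha>\<close> and \<open>\<beta>\<close> are the four martingale increments\<close>
  have r1: "a * u = b * \<alpha>"
    using step_mean_incr[of False] c0
    by (simp add: step_mean_def incr_def xyzw[symmetric] abcd[symmetric] m_def[symmetric] e_def[symmetric] u_def \<alpha>_def algebra_simps)
  have r2: "d * t = c * \<beta>"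
    using step_mean_incr[of True] c0
    by (simp add: step_mean_def incr_def xyzw[symmetric] abcd[symmetric] m_def[symmetric] e_def[symmetric] t_def \<beta>_def algebra_simps)
  have "l * \<delta> = a * c * x\<^sup>2 + b * d * w\<^sup>2 - 2 * ((m - a * x) * (m - d * w)) + b * c * (y + z)\<^sup>2"
    using l unfolding d2 by (simp add: ab \<delta>_def power2_eq_square field_simps)
  also have "a * c * x\<^sup>2 = a * c * m\<^sup>2 - 2 * c * m * (a * u) + a * c * u\<^sup>2"
    by (simp add: sub power2_eq_square algebra_simps)
  also have "b * d * w\<^sup>2 = b * d * m\<^sup>2 - 2 * b * m * (d * t) + b * d * t\<^sup>2"
    by (simp add: sub power2_eq_square algebra_simps)
  also have "m - a * x = b * m + a * u" by (simp add: sub ab algebra_simps)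
  also have "m - d * w = c * m + d * t" by (simp add: sub ab algebra_simps)
  also have "y + z = 2 * m + \<alpha> + \<beta>" by (simp add: sub)
  finally have "(l - m\<^sup>2) * \<delta> = var_rate * \<delta>"
    unfolding v r1 r2 left_diff_distrib
    by (simp add: u_def[symmetric] t_def[symmetric] \<alpha>_def[symmetric] \<beta>_def[symmetric] power2_commute[of x m] power2_commute[of w m])
      (simp add: ab \<delta>_def power2_eq_square algebra_simps)
  then have "l - m\<^sup>2 = var_rate" using \<delta> by simp
  then show ?thesis unfolding limit_variance_def l1 l_def[symmetric] by (simp add: m_def)
qed

end

section \<open>Finite trajectories and the stopped martingale\<close>

context binary_chain
begin

text \<open>The conditional probability of continuing with the bits of the list, given the present state.\<close>
primrec path_weight :: "bool \<Rightarrow> bool list \<Rightarrow> real" where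
  "path_weight i [] = 1"
| "path_weight i (j # u) = p i j * path_weight j u"

primrec path_pmf :: "nat \<Rightarrow> bool \<Rightarrow> bool list pmf" where
  "path_pmf 0 i = return_pmf []"
| "path_pmf (Suc k) i = bernoulli_pmf (p i True) \<bind> (\<lambda>j. map_pmf (Cons j) (path_pmf k j))"

text \<open>Prefixes of length \<open>K + 1\<close>; the initial bit is kept apart since it does not follow a transition.\<close>
definition word_pmf :: "(bool \<Rightarrow> real) \<Rightarrow> nat \<Rightarrow> bool list pmf" where
  "word_pmf \<mu> K = bernoulli_pmf (\<mu> True) \<bind> (\<lambda>i. map_pmf (Cons i) (path_pmf K i))"

definition min_info :: real where
  "min_info = Min (range (\<lambda>(i, j). info i j))"

definition max_info :: real where
  "max_info = Max (range (\<lambda>(i, j). info i j))"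

lemma info_bounds: "min_info \<le> info i j" "info i j \<le> max_info"
  unfolding min_info_def max_info_def by (auto intro!: Min_le Max_ge)

lemma min_info_pos: "0 < min_info"
  unfolding min_info_def by (subst Min_gr_iff) (auto simp: info_pos)

lemma exp_info: "exp (- info i j) = p i j"
  using p_pos[of i j] by (simp add: info_def)

lemma p_le: "p i j \<le> exp (- min_info)"
proof -
  have "exp (- info i j) \<le> exp (- min_info)" using info_bounds(1)[of i j] by simp
  then show ?thesis by (simp only: exp_info)
qed

lemma path_weight_pos: "0 < path_weight i u"
  by (induction u arbitrary: i) (auto simp: p_pos)

lemma path_weight_le_1: "path_weight i u \<le> 1"
  by (induction u arbitrary: i) (auto intro!: mult_le_one path_weight_pos[THEN less_imp_le] p_less_1[THEN less_imp_le])

lemma path_weight_take_Suc: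
  "k < length u \<Longrightarrow> path_weight i (take (Suc k) u) \<le> exp (- min_info) * path_weight i (take k u)"
proof (induction u arbitrary: i k)
  case (Cons j u)
  show ?case
  proof (cases k)
    case 0
    then show ?thesis by (simp add: p_le)
  next
    case (Suc k')
    then have "path_weight j (take (Suc k') u) \<le> exp (- min_info) * path_weight j (take k' u)"
      using Cons by simp
    then show ?thesis using p_pos[of i j] Suc by (simp add: mult.left_commute mult_left_mono)
  qed
qed simp

lemma path_weight_snoc: "path_weight i (u @ [j]) = path_weight i u * p (last (i # u)) j"
  by (induction u arbitrary: i) auto

lemma length_path_pmf: "u \<in> set_pmf (path_pmf k i) \<Longrightarrow> length u = k"
  by (induction k arbitrary: i u) auto

lemma finite_path_pmf: "finite (set_pmf (path_pmf k i))"
  by (induction k arbitrary: i) auto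

lemma finite_word_pmf: "finite (set_pmf (word_pmf \<mu> K))"
  by (auto simp: word_pmf_def finite_path_pmf)

lemma word_pmf_cases:
  assumes "w \<in> set_pmf (word_pmf \<mu> K)"
  obtains i u where "w = i # u" "length u = K"
  using assms by (auto simp: word_pmf_def dest: length_path_pmf)

lemma p_True_bounds: "0 \<le> p i True" "p i True \<le> 1"
  using p_pos[of i True] p_less_1[of i True] by auto

lemma expectation_bernoulli_bind:
  fixes h :: "'b \<Rightarrow> 'c::{banach, second_countable_topology}"
  assumes "0 \<le> r" "r \<le> 1" "\<And>j. finite (set_pmf (Q j))"
  shows "measure_pmf.expectation (bernoulli_pmf r \<bind> Q) h =
    (1 - r) *\<^sub>R measure_pmf.expectation (Q False) h + r *\<^sub>R measure_pmf.expectation (Q True) h"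
  using assms by (subst pmf_expectation_bind[of UNIV]) (auto simp: UNIV_bool)

lemma expectation_path_pmf_Suc:
  fixes h :: "bool list \<Rightarrow> real"
  shows "measure_pmf.expectation (path_pmf (Suc k) i) h
    = step_mean i (\<lambda>j. measure_pmf.expectation (path_pmf k j) (\<lambda>u. h (j # u)))"
  by (simp add: expectation_bernoulli_bind p_True_bounds finite_path_pmf step_mean_def p_False[of i])

lemma expectation_word_pmf:
  fixes h :: "bool list \<Rightarrow> real"
  assumes "0 \<le> \<mu> True" "\<mu> True \<le> 1" "\<mu> False + \<mu> True = 1"
  shows "measure_pmf.expectation (word_pmf \<mu> K) h
    = \<mu> False * measure_pmf.expectation (path_pmf K False) (\<lambda>u. h (False # u))
    + \<mu> True * measure_pmf.expectation (path_pmf K True) (\<lambda>u. h (True # u))"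
proof -
  have "\<mu> False = 1 - \<mu> True" using assms by simp
  then show ?thesis using assms unfolding word_pmf_def
    by (simp add: expectation_bernoulli_bind finite_path_pmf)
qed

lemma pmf_bernoulli_bind:
  assumes "0 \<le> r" "r \<le> 1"
  shows "pmf (bernoulli_pmf r \<bind> (\<lambda>j. map_pmf (Cons j) (Q j))) (i # u)
       = (if i then r else 1 - r) * pmf (Q i) u"
proof -
  have "pmf (map_pmf (Cons j) (Q j)) (i # u) = (if i = j then pmf (Q i) u else 0)" for j
  proof (cases "i = j")
    case True
    then show ?thesis using pmf_map_inj'[of "Cons j" "Q j" u] by (simp add: inj_on_def)
  next
    case False
    then have "i # u \<notin> set_pmf (map_pmf (Cons j) (Q j))" by auto
    then have "pmf (map_pmf (Cons j) (Q j)) (i # u) = 0" by (simp only: set_pmf_iff not_not)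
    then show ?thesis using False by (simp only: if_False)
  qed
  then show ?thesis using assms by (simp add: pmf_bind)
qed

lemma pmf_path_pmf: "length u = k \<Longrightarrow> pmf (path_pmf k i) u = path_weight i u"
proof (induction u arbitrary: i k)
  case (Cons j u)
  then have "k = Suc (length u)" by simp
  then show ?case using Cons.IH[of "length u" j]
    by (simp add: pmf_bernoulli_bind p_True_bounds p_False[of i])
qed simp

lemma pmf_word_pmf:
  assumes "0 \<le> \<mu> True" "\<mu> True \<le> 1" "\<mu> False + \<mu> True = 1" "length u = K"
  shows "pmf (word_pmf \<mu> K) (i # u) = \<mu> i * path_weight i u"
proof -
  have "\<mu> False = 1 - \<mu> True" using assms by simp
  then show ?thesis using assms unfolding word_pmf_def
    by (subst pmf_bernoulli_bind) (auto simp: pmf_path_pmf)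
qed

lemma map_take_path_pmf: "k \<le> K \<Longrightarrow> map_pmf (take k) (path_pmf K i) = path_pmf k i"
proof (induction k arbitrary: K i)
  case 0
  have "map_pmf (take 0) (path_pmf K i) = map_pmf (\<lambda>_. []) (path_pmf K i)"
    by (rule map_pmf_cong) auto
  then show ?case by simp
next
  case (Suc k)
  then obtain K' where K: "K = Suc K'" "k \<le> K'" by (cases K) auto
  have "map_pmf (take (Suc k)) (map_pmf (Cons j) (path_pmf K' j)) = map_pmf (Cons j) (map_pmf (take k) (path_pmf K' j))" for j
    by (simp add: pmf.map_comp o_def)
  then show ?case using Suc.IH[OF K(2)] K by (simp add: map_bind_pmf)
qed

lemma map_take_word_pmf:
  assumes "k \<le> K" shows "map_pmf (take (Suc k)) (word_pmf \<mu> K) = word_pmf \<mu> k"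
proof -
  have "map_pmf (take (Suc k)) (map_pmf (Cons j) (path_pmf K j)) = map_pmf (Cons j) (map_pmf (take k) (path_pmf K j))" for j
    by (simp add: pmf.map_comp o_def)
  then show ?thesis by (simp add: word_pmf_def map_bind_pmf map_take_path_pmf assms)
qed

lemma prob_take_word_pmf:
  assumes "0 \<le> \<mu> True" "\<mu> True \<le> 1" "\<mu> False + \<mu> True = 1" "length u = k" "k \<le> K"
  shows "measure_pmf.prob (word_pmf \<mu> K) {w. take (Suc k) w = i # u} = \<mu> i * path_weight i u"
proof -
  have "\<mu> i * path_weight i u = measure_pmf.prob (map_pmf (take (Suc k)) (word_pmf \<mu> K)) {i # u}"
    using assms by (simp add: map_take_word_pmf measure_pmf_single pmf_word_pmf)
  also have "\<dots> = measure_pmf.prob (word_pmf \<mu> K) {w. take (Suc k) w = i # u}"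
    by (simp add: vimage_def)
  finally show ?thesis by simp
qed

text \<open>
  For \<open>T = ln n\<close> and initial bit \<open>i\<close>, this counts the nonempty prefixes whose weight exceeds \<open>1 / n\<close>. The
  probability of the initial bit is left out of the weight; if positive, it would change the
  count by a bounded amount only.
\<close>
definition passage :: "real \<Rightarrow> bool \<Rightarrow> bool list \<Rightarrow> real" where
  "passage T i u = (\<Sum>k<length u. of_bool (1 < exp T * path_weight i (take k u)))"

lemma passage_Nil [simp]: "passage T i [] = 0"
  by (simp add: passage_def)

lemma passage_Cons:
  "passage T i (j # u) = (if 0 < T then 1 + passage (T - info i j) j u else 0)"
proof (cases "0 < T")
  case True
  have "exp T * p i j = exp (T - info i j)"
    by (simp only: exp_info[of i j, symmetric] exp_add[symmetric]) simp
  then show ?thesis using True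
    by (simp add: passage_def sum.lessThan_Suc_shift mult.assoc[symmetric] del: sum.lessThan_Suc sum_of_bool_eq)
next
  case False
  have "exp T * path_weight i v \<le> 1" for v
    using mult_le_one[of "exp T" "path_weight i v"] False path_weight_le_1[of i v] path_weight_pos[of i v]
    by (simp add: less_imp_le)
  then show ?thesis using False by (simp add: passage_def not_less[symmetric])
qed

text \<open>
  The budget \<open>T\<close> is reduced by the information of every transition, and the martingale stops as soon as
  it is used up. Stopping before the transition that would start from a nonpositive budget makes the
  number of summands equal to \<open>passage\<close>.
\<close>
primrec stopped_sum :: "real \<Rightarrow> bool \<Rightarrow> bool list \<Rightarrow> real" where
  "stopped_sum T i [] = 0"
| "stopped_sum T i (j # u) = (if 0 < T then incr i j + stopped_sum (T - info i j) j u else 0)"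

lemma step_mean_const [simp]: "step_mean i (\<lambda>_. c) = c"
  using p_row[of i] by (simp add: step_mean_def flip: distrib_right)

lemma step_mean_add: "step_mean i (\<lambda>j. f j + g j) = step_mean i f + step_mean i g"
  by (simp add: step_mean_def algebra_simps)

lemma step_mean_abs_le:
  assumes "\<And>j. \<bar>f j\<bar> \<le> C" shows "\<bar>step_mean i f\<bar> \<le> C"
proof -
  have "\<bar>step_mean i f\<bar> \<le> p i False * \<bar>f False\<bar> + p i True * \<bar>f True\<bar>"
    unfolding step_mean_def using p_pos[of i] 
    by (intro order.trans[OF abs_triangle_ineq]) (simp add: abs_mult abs_of_pos)
  also have "\<dots> \<le> p i False * C + p i True * C"
    using assms p_pos by (intro add_mono mult_left_mono) (auto simp: less_imp_le)
  finally show ?thesis using p_row[of i] by (simp flip: distrib_right)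
qed

lemma expectation_stopped_sum: "measure_pmf.expectation (path_pmf k i) (stopped_sum T i) = 0"
proof (induction k arbitrary: T i)
  case (Suc k)
  note [simp] = integrable_measure_pmf_finite[OF finite_path_pmf]
  show ?case
    by (cases "0 < T") (simp_all add: expectation_path_pmf_Suc Suc step_mean_incr del: path_pmf.simps)
qed simp

lemma expectation_stopped_sum_square_Suc:
  assumes "0 < T"
  shows "measure_pmf.expectation (path_pmf (Suc k) i) (\<lambda>u. (stopped_sum T i u)\<^sup>2)
    = incr_var i + step_mean i (\<lambda>j. measure_pmf.expectation (path_pmf k j) (\<lambda>u. (stopped_sum (T - info i j) j u)\<^sup>2))"
proof -
  note [simp] = integrable_measure_pmf_finite[OF finite_path_pmf]
  have "measure_pmf.expectation (path_pmf k j) (\<lambda>u. (stopped_sum T i (j # u))\<^sup>2)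
    = (incr i j)\<^sup>2 + measure_pmf.expectation (path_pmf k j) (\<lambda>u. (stopped_sum (T - info i j) j u)\<^sup>2)" for j
  proof -
    have "measure_pmf.expectation (path_pmf k j) (\<lambda>u. (stopped_sum T i (j # u))\<^sup>2)
      = measure_pmf.expectation (path_pmf k j) (\<lambda>u. (incr i j)\<^sup>2
          + (2 * incr i j) * stopped_sum (T - info i j) j u + (stopped_sum (T - info i j) j u)\<^sup>2)"
      using assms by (intro arg_cong[where f="measure_pmf.expectation _"]) (auto simp: power2_sum algebra_simps)
    also have "\<dots> = (incr i j)\<^sup>2 + measure_pmf.expectation (path_pmf k j) (\<lambda>u. (stopped_sum (T - info i j) j u)\<^sup>2)"
      by (simp add: expectation_stopped_sum measure_pmf.prob_space)
    finally show ?thesis .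
  qed
  then show ?thesis
    by (simp only: expectation_path_pmf_Suc step_mean_add incr_var_def)
qed

definition stopped_rate :: real where
  "stopped_rate = var_rate / rate"

lemma ex_bool_bound: "\<exists>C\<ge>0. \<forall>i::bool. \<bar>f i :: real\<bar> \<le> C"
proof (intro exI[of _ "max \<bar>f True\<bar> \<bar>f False\<bar>"] conjI allI)
  show "\<bar>f i\<bar> \<le> max \<bar>f True\<bar> \<bar>f False\<bar>" for i by (cases i) auto
qed auto

text \<open>
  By orthogonality of the increments the second moment is the expected sum of their conditional
  variances up to the passage time. Conditioning on the first transition gives a recursion in \<open>T\<close>, and
  \<open>stopped_rate * T + h i\<close> solves it exactly if \<open>h\<close> solves the Poisson equation for
  \<open>incr_var - stopped_rate * step_entropy\<close>, which has stationary mean zero by the choice of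
  \<open>stopped_rate\<close>. The only error arises at the end, where the budget overshoots zero by at most
  \<open>max_info\<close>. The bound on \<open>T\<close> ensures that the budget is used up before the trajectory ends.
\<close>
lemma stopped_sum_second_moment:
  "\<exists>C\<ge>0. \<forall>T k i. - max_info \<le> T \<longrightarrow> T \<le> min_info * real k \<longrightarrow>
     \<bar>measure_pmf.expectation (path_pmf k i) (\<lambda>u. (stopped_sum T i u)\<^sup>2) - stopped_rate * T\<bar> \<le> C"
proof -
  define f where "f = (\<lambda>i. incr_var i - stopped_rate * step_entropy i)"
  define h where "h = corrector f"
  have "stationary_mean f = var_rate - stopped_rate * rate"
    unfolding f_def stationary_mean_def var_rate_def rate_def
    by (simp add: diff_divide_distrib add_divide_distrib algebra_simps)
  then have "stationary_mean f = 0" using rate_pos by (simp add: stopped_rate_def)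
  then have h: "incr_var i - stopped_rate * step_entropy i + step_mean i h - h i = 0" for i
    using poisson_equation[of f i] by (simp add: h_def f_def)
  obtain H where H: "\<And>i. \<bar>h i\<bar> \<le> H" "0 \<le> H" using ex_bool_bound[of h] by blast
  have sr: "0 \<le> stopped_rate"
  proof -
    have "0 \<le> incr_var i" for i
      using p_pos[of i] by (simp add: incr_var_def step_mean_def less_imp_le)
    then show ?thesis using p_pos rate_pos
      by (simp add: stopped_rate_def var_rate_def stationary_mean_def less_imp_le)
  qed
  have mi: "0 < max_info" using info_pos[of True True] info_bounds(2)[of True True] by linarith
  define C where "C = stopped_rate * max_info + H"
  have Z: "\<bar>measure_pmf.expectation (path_pmf k i) (\<lambda>u. (stopped_sum T i u)\<^sup>2) - stopped_rate * T - h i\<bar> \<le> C"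
    if "- max_info \<le> T" "T \<le> min_info * real k" for T k i
    using that
  proof (induction k arbitrary: T i)
    case 0
    have "stopped_rate * - T \<le> stopped_rate * max_info" using 0 sr by (intro mult_left_mono) auto
    moreover have "0 \<le> stopped_rate * - T" using 0 sr by (intro mult_nonneg_nonneg) auto
    ultimately show ?case using H(1)[of i] by (simp add: C_def)
  next
    case (Suc k)
    show ?case
    proof (cases "0 < T")
      case False
      have "stopped_sum T i u = 0" for u using False by (cases u) auto
      moreover have "stopped_rate * - T \<le> stopped_rate * max_info" using Suc.prems sr by (intro mult_left_mono) auto
      moreover have "0 \<le> stopped_rate * - T" using False sr by (intro mult_nonneg_nonneg) auto
      ultimately show ?thesis using H(1)[of i] by (simp add: C_def)
    next
      case True
      define E where "E j = measure_pmf.expectation (path_pmf k j) (\<lambda>u. (stopped_sum (T - info i j) j u)\<^sup>2)" for j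
      have "measure_pmf.expectation (path_pmf (Suc k) i) (\<lambda>u. (stopped_sum T i u)\<^sup>2) = incr_var i + step_mean i E"
        unfolding E_def by (rule expectation_stopped_sum_square_Suc[OF True])
      also have "\<dots> - stopped_rate * T - h i = step_mean i (\<lambda>j. E j - stopped_rate * (T - info i j) - h j)"
      proof -
        have "step_mean i (\<lambda>j. E j - stopped_rate * (T - info i j) - h j)
          = step_mean i E - (p i False + p i True) * (stopped_rate * T) + stopped_rate * step_entropy i - step_mean i h"
          by (simp add: step_mean_def step_entropy_def algebra_simps)
        then show ?thesis using h[of i] p_row[of i] by simp
      qed
      finally have eq: "measure_pmf.expectation (path_pmf (Suc k) i) (\<lambda>u. (stopped_sum T i u)\<^sup>2) - stopped_rate * T - h i
        = step_mean i (\<lambda>j. E j - stopped_rate * (T - info i j) - h j)" .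
      show ?thesis unfolding eq
      proof (rule step_mean_abs_le)
        fix j
        show "\<bar>E j - stopped_rate * (T - info i j) - h j\<bar> \<le> C"
          unfolding E_def
        proof (rule Suc.IH)
          show "- max_info \<le> T - info i j" using info_bounds(2)[of i j] True by linarith
          show "T - info i j \<le> min_info * real k"
            using info_bounds(1)[of i j] Suc.prems(2) by (simp add: algebra_simps)
        qed
      qed
    qed
  qed
  have "0 \<le> C" using sr mi H(2) by (simp add: C_def)
  show ?thesis
  proof (intro exI[of _ "C + H"] conjI allI impI)
    show "0 \<le> C + H" using \<open>0 \<le> C\<close> H by simp
    fix T k i assume "- max_info \<le> T" "T \<le> min_info * real k"
    from Z[OF this, of i] H(1)[of i]
    show "\<bar>measure_pmf.expectation (path_pmf k i) (\<lambda>u. (stopped_sum T i u)\<^sup>2) - stopped_rate * T\<bar> \<le> C + H"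
      by linarith
  qed
qed

text \<open>
  Summing the increments, the information adds up to \<open>T\<close> plus the overshoot, the drift to
  \<open>rate * passage\<close>, and the correctors telescope.
\<close>
lemma stopped_sum_passage:
  "\<exists>C\<ge>0. \<forall>T i u. - max_info \<le> T \<longrightarrow> T \<le> min_info * real (length u) \<longrightarrow>
     \<bar>stopped_sum T i u - (T - rate * passage T i u)\<bar> \<le> C"
proof -
  let ?h = "corrector step_entropy"
  obtain H where H: "\<And>i. \<bar>?h i\<bar> \<le> H" "0 \<le> H" using ex_bool_bound[of ?h] by blast
  have mi: "0 < max_info" using info_pos[of True True] info_bounds(2)[of True True] by linarith
  have Z: "\<bar>stopped_sum T i u - (T - rate * passage T i u) + ?h i\<bar> \<le> max_info + H"
    if "- max_info \<le> T" "T \<le> min_info * real (length u)" for T i u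
    using that
  proof (induction u arbitrary: T i)
    case Nil
    then show ?case using H(1)[of i] by simp
  next
    case (Cons j u)
    show ?case
    proof (cases "0 < T")
      case False
      then show ?thesis using Cons.prems H(1)[of i] by (simp add: passage_Cons)
    next
      case True
      have "stopped_sum T i (j # u) - (T - rate * passage T i (j # u)) + ?h i
          = stopped_sum (T - info i j) j u - ((T - info i j) - rate * passage (T - info i j) j u) + ?h j"
        using True by (simp add: passage_Cons incr_def algebra_simps)
      moreover have "- max_info \<le> T - info i j" using info_bounds(2)[of i j] True by linarith
      moreover have "T - info i j \<le> min_info * real (length u)"
        using info_bounds(1)[of i j] Cons.prems(2) by (simp add: algebra_simps)
      ultimately show ?thesis using Cons.IH[of "T - info i j" j] by simp
    qed
  qed
  show ?thesis
  proof (intro exI[of _ "max_info + H + H"] conjI allI impI)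
    show "0 \<le> max_info + H + H" using mi H by simp
    fix T i and u :: "bool list" assume "- max_info \<le> T" "T \<le> min_info * real (length u)"
    from Z[OF this, of i] H(1)[of i]
    show "\<bar>stopped_sum T i u - (T - rate * passage T i u)\<bar> \<le> max_info + H + H" by linarith
  qed
qed

text \<open>The budget decreases by at least \<open>min_info\<close> per step, so there are at most \<open>T / min_info + 1\<close> steps.\<close>
lemma stopped_sum_bound: "\<exists>C\<ge>0. \<forall>T i u. 0 \<le> T \<longrightarrow> \<bar>stopped_sum T i u\<bar> \<le> C * (1 + T)"
proof -
  obtain B1 where B1: "\<And>i. \<bar>incr i True\<bar> \<le> B1" using ex_bool_bound[of "\<lambda>i. incr i True"] by blast
  obtain B2 where B2: "\<And>i. \<bar>incr i False\<bar> \<le> B2" using ex_bool_bound[of "\<lambda>i. incr i False"] by blast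
  define B where "B = max B1 B2"
  have B: "\<bar>incr i j\<bar> \<le> B" for i j using B1[of i] B2[of i] by (cases j) (auto simp: B_def)
  then have B0: "0 \<le> B" by (meson abs_ge_zero order.trans)
  have *: "\<bar>stopped_sum T i u\<bar> \<le> (if 0 < T then B * (T / min_info + 1) else 0)" for T i u
  proof (induction u arbitrary: T i)
    case (Cons j u)
    show ?case
    proof (cases "0 < T")
      case True
      define T' where "T' = T - info i j"
      have T': "T' \<le> T - min_info" using info_bounds(1)[of i j] by (simp add: T'_def)
      have "\<bar>stopped_sum T' j u\<bar> \<le> B * (T / min_info)"
      proof (cases "0 < T'")
        case True
        have "T' / min_info + 1 \<le> T / min_info"
        proof -
          have "T' / min_info + 1 = (T' + min_info) / min_info" using min_info_pos by (simp add: add_divide_distrib)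
          also have "\<dots> \<le> T / min_info" using T' min_info_pos by (intro divide_right_mono) auto
          finally show ?thesis .
        qed
        then have "B * (T' / min_info + 1) \<le> B * (T / min_info)" using B0 by (rule mult_left_mono)
        then show ?thesis using Cons.IH[of T' j] True by simp
      next
        case False
        then show ?thesis using Cons.IH[of T' j] \<open>0 < T\<close> B0 min_info_pos by simp
      qed
      then show ?thesis using True B[of i j] by (simp add: T'_def[symmetric] algebra_simps)
    qed simp
  qed (use B0 min_info_pos in simp)
  show ?thesis
  proof (intro exI[of _ "B * (1 / min_info + 1)"] conjI allI impI)
    show "0 \<le> B * (1 / min_info + 1)" using B0 min_info_pos by simp
    fix T :: real and i u assume "0 \<le> T"
    then have "T / min_info + 1 \<le> (1 / min_info + 1) * (1 + T)"
      using min_info_pos by (simp add: field_simps)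
    then have "B * (T / min_info + 1) \<le> B * ((1 / min_info + 1) * (1 + T))" using B0 by (rule mult_left_mono)
    moreover have "0 \<le> B * (T / min_info + 1)" using B0 min_info_pos \<open>0 \<le> T\<close> by simp
    ultimately show "\<bar>stopped_sum T i u\<bar> \<le> B * (1 / min_info + 1) * (1 + T)"
      using *[of T i u] by (auto split: if_splits simp: mult.assoc)
  qed
qed

end

section \<open>The variance of the remainder is linear\<close>

lemma expectation_pair_pmf_finite_fst:
  fixes h :: "'a \<times> 'b \<Rightarrow> real"
  assumes "finite (set_pmf P)" "finite (set_pmf Q)"
  shows "measure_pmf.expectation (pair_pmf P Q) h
       = measure_pmf.expectation P (\<lambda>y. measure_pmf.expectation Q (\<lambda>f. h (y, f)))"
  by (subst pair_commute_pmf) (simp add: expectation_pair_pmf_finite assms case_prod_unfold)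

lemma expectation_Pi_pmf_le:
  fixes h :: "('a \<Rightarrow> 'b) \<Rightarrow> real"
  assumes A: "finite A" "x \<in> A" and P: "finite (set_pmf P)"
    and le: "\<And>y. y \<in> set_pmf P \<Longrightarrow> measure_pmf.expectation (Pi_pmf (A - {x}) d (\<lambda>_. P)) (\<lambda>f. h (f(x := y))) \<le> C"
  shows "measure_pmf.expectation (Pi_pmf A d (\<lambda>_. P)) h \<le> C"
proof -
  define Q where "Q = Pi_pmf (A - {x}) d (\<lambda>_. P)"
  have Q: "finite (set_pmf Q)" unfolding Q_def by (rule finite_set_Pi_pmf) (use A P in auto)
  have "Pi_pmf A d (\<lambda>_. P) = map_pmf (\<lambda>(y, f). f(x := y)) (pair_pmf P Q)"
    using Pi_pmf_insert[of "A - {x}" x d "\<lambda>_. P"] A by (simp add: insert_absorb Q_def)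
  then have "measure_pmf.expectation (Pi_pmf A d (\<lambda>_. P)) h
      = measure_pmf.expectation P (\<lambda>y. measure_pmf.expectation Q (\<lambda>f. h (f(x := y))))"
    by (simp add: expectation_pair_pmf_finite_fst P Q case_prod_unfold)
  also have "\<dots> \<le> measure_pmf.expectation P (\<lambda>_. C)"
    using le by (intro pmf_expectation_mono P) (simp add: Q_def)
  finally show ?thesis by (simp add: measure_pmf.prob_space)
qed

lemma expectation_component:
  fixes h :: "'b \<Rightarrow> real"
  assumes "finite A" "l \<in> A"
  shows "measure_pmf.expectation (Pi_pmf A d (\<lambda>_. P)) (\<lambda>f. h (f l)) = measure_pmf.expectation P h"
proof -
  have "measure_pmf.expectation (Pi_pmf A d (\<lambda>_. P)) (\<lambda>f. h (f l))
      = measure_pmf.expectation (map_pmf (\<lambda>f. f l) (Pi_pmf A d (\<lambda>_. P))) h" by simp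
  also have "map_pmf (\<lambda>f. f l) (Pi_pmf A d (\<lambda>_. P)) = P" using assms by (subst Pi_pmf_component) auto
  finally show ?thesis .
qed

lemma expectation_card_hits:
  assumes "finite A" "finite (set_pmf P)"
  shows "measure_pmf.expectation (Pi_pmf A d (\<lambda>_. P)) (\<lambda>f. real (card {l \<in> A. f l \<in> E}))
       = real (card A) * measure_pmf.prob P E"
proof -
  have "real (card {l \<in> A. f l \<in> E}) = (\<Sum>l\<in>A. indicator E (f l))" for f
    using assms(1) by (simp add: indicator_def Int_def conj_commute)
  then have "measure_pmf.expectation (Pi_pmf A d (\<lambda>_. P)) (\<lambda>f. real (card {l \<in> A. f l \<in> E}))
      = (\<Sum>l\<in>A. measure_pmf.expectation (Pi_pmf A d (\<lambda>_. P)) (\<lambda>f. indicator E (f l)))"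
    by (simp add: Bochner_Integration.integral_sum integrable_measure_pmf_finite finite_set_Pi_pmf assms)
  also have "\<dots> = (\<Sum>l\<in>A. measure_pmf.prob P E)"
    using assms by (intro sum.cong refl) (simp add: expectation_component)
  finally show ?thesis by simp
qed

lemma expectation_half_power_hits:
  assumes A: "finite A" and P: "finite (set_pmf P)"
  shows "measure_pmf.expectation (Pi_pmf A d (\<lambda>_. P)) (\<lambda>f. (1/2 :: real) ^ card {l \<in> A. f l \<in> E})
       = (1 - measure_pmf.prob P E / 2) ^ card A"
proof -
  have "(1/2 :: real) ^ card {l \<in> A. f l \<in> E} = (\<Prod>l\<in>A. 1 - indicator E (f l) / 2)" for f
  proof -
    have "(\<Prod>l\<in>A. 1 - indicator E (f l) / 2) = (\<Prod>l\<in>A. if f l \<in> E then 1/2 else 1 :: real)"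
      by (intro prod.cong) auto
    also have "\<dots> = (\<Prod>l\<in>{l \<in> A. f l \<in> E}. 1/2)"
      using A by (simp add: prod.If_cases Int_def)
    finally show ?thesis by simp
  qed
  then have "measure_pmf.expectation (Pi_pmf A d (\<lambda>_. P)) (\<lambda>f. (1/2 :: real) ^ card {l \<in> A. f l \<in> E})
      = (\<Prod>l\<in>A. measure_pmf.expectation P (\<lambda>w. 1 - indicator E w / 2))"
    by (simp only:) (rule expectation_prod_Pi_pmf[OF A], auto intro: integrable_measure_pmf_finite[OF P] split: split_indicator)
  also have "measure_pmf.expectation P (\<lambda>w. 1 - indicator E w / 2) = 1 - measure_pmf.prob P E / 2"
    by (simp add: integrable_measure_pmf_finite[OF P] measure_pmf.prob_space)
  finally show ?thesis by simp
qed

text \<open>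
  The left-hand side is the expectation of \<open>(1/2) ^ N\<close> for a binomial \<open>N\<close> with parameters \<open>n - 1\<close> and
  \<open>\<pi>\<close>; it controls the probability of \<open>N \<le> 1\<close>.
\<close>
lemma power_one_minus_half_le:
  fixes \<pi> :: real
  assumes "0 < \<pi>" "\<pi> \<le> 1" "1 \<le> n"
  shows "(1 - \<pi> / 2) ^ (n - 1) \<le> 2 / (real n * \<pi>)"
proof -
  have "(1 - \<pi> / 2) ^ (n - 1) \<le> exp (- (\<pi> / 2)) ^ (n - 1)"
    using exp_ge_add_one_self[of "- (\<pi> / 2)"] assms by (intro power_mono) auto
  also have "\<dots> = 1 / exp (real (n - 1) * (\<pi> / 2))"
    by (simp add: exp_of_nat_mult[symmetric] exp_minus field_simps)
  also have "\<dots> \<le> 1 / (real n * \<pi> / 2)"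
  proof (rule divide_left_mono)
    have eq: "1 + real (n - 1) * (\<pi> / 2) = real n * \<pi> / 2 + (1 - \<pi> / 2)"
      using assms by (simp add: of_nat_diff left_diff_distrib)
    have "real n * \<pi> / 2 \<le> 1 + real (n - 1) * (\<pi> / 2)"
      unfolding eq using assms by simp
    also have "\<dots> \<le> exp (real (n - 1) * (\<pi> / 2))" by (rule exp_ge_add_one_self)
    finally show "real n * \<pi> / 2 \<le> exp (real (n - 1) * (\<pi> / 2))" .
  qed (use assms in auto)
  finally show ?thesis by simp
qed

locale markov_words = binary_chain p for p +
  fixes \<mu> :: "bool \<Rightarrow> real"
  assumes mu_nonneg: "0 \<le> \<mu> i" and mu_sum: "\<mu> False + \<mu> True = 1"
begin

lemma mu_le_1: "\<mu> i \<le> 1"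
  using mu_nonneg[of True] mu_nonneg[of False] mu_sum by (cases i) auto

lemma expectation_word:
  "measure_pmf.expectation (word_pmf \<mu> K) h
    = \<mu> False * measure_pmf.expectation (path_pmf K False) (\<lambda>u. h (False # u))
    + \<mu> True * measure_pmf.expectation (path_pmf K True) (\<lambda>u. h (True # u))" for h :: "bool list \<Rightarrow> real"
  by (rule expectation_word_pmf) (use mu_nonneg mu_le_1 mu_sum in auto)

lemma prob_take_word:
  "length u = k \<Longrightarrow> k \<le> K \<Longrightarrow> measure_pmf.prob (word_pmf \<mu> K) {w. take (Suc k) w = i # u} = \<mu> i * path_weight i u"
  by (rule prob_take_word_pmf) (use mu_nonneg mu_le_1 mu_sum in auto)

lemma pmf_word: "length u = K \<Longrightarrow> pmf (word_pmf \<mu> K) (i # u) = \<mu> i * path_weight i u"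
  by (rule pmf_word_pmf) (use mu_nonneg mu_le_1 mu_sum in auto)

definition words_pmf :: "nat \<Rightarrow> nat \<Rightarrow> (nat \<Rightarrow> bool list) pmf" where
  "words_pmf K n = Pi_pmf {..<n} [] (\<lambda>_. word_pmf \<mu> K)"

definition stopped_word :: "real \<Rightarrow> bool list \<Rightarrow> real" where
  "stopped_word T w = stopped_sum T (hd w) (tl w)"

definition level_sum :: "nat \<Rightarrow> (nat \<Rightarrow> bool list) \<Rightarrow> nat set \<Rightarrow> real" where
  "level_sum K f J = (\<Sum>k<K. real (level_count (Suc k) f J))"

lemma finite_words_pmf: "finite (set_pmf (words_pmf K n))"
  unfolding words_pmf_def by (rule finite_set_Pi_pmf) (auto simp: finite_word_pmf)

text \<open>The smallest positive initial probability.\<close>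
definition mu_min :: real where
  "mu_min = (if \<mu> True = 0 then \<mu> False else if \<mu> False = 0 then \<mu> True else min (\<mu> False) (\<mu> True))"

lemma mu_min_pos: "0 < mu_min"
  using mu_nonneg[of True] mu_nonneg[of False] mu_sum by (auto simp: mu_min_def)

lemma mu_min_le: "0 < \<mu> i \<Longrightarrow> mu_min \<le> \<mu> i"
  by (cases i) (auto simp: mu_min_def)

lemma mu_min_le_1: "mu_min \<le> 1"
  using mu_le_1[of True] mu_le_1[of False] by (auto simp: mu_min_def)

text \<open>
  Here \<open>d\<close> compares, level by level, what string \<open>i\<close> contributes to the external path length with its
  share in \<open>passage\<close>. With \<open>b k\<close> denoting \<open>n\<close> times the weight of its prefix at level \<open>k\<close>, the
  expectation of \<open>(d k)\<^sup>2\<close> is of order \<open>min (b k) (1 / b k)\<close>, the square of the weight \<open>\<theta> k\<close> used in the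
  Cauchy-Schwarz inequality.
\<close>
lemma removal_second_moment:
  fixes n K i i0 u
  assumes i: "i < n" and u: "length u = K" and mu: "0 < \<mu> i0"
  defines "w \<equiv> i0 # u"
  defines "d \<equiv> \<lambda>f k. real (level_count (Suc k) f {..<n}) - real (level_count (Suc k) f ({..<n} - {i}))
                       - of_bool (1 < real n * path_weight i0 (take k u))"
  shows "measure_pmf.expectation (Pi_pmf ({..<n} - {i}) [] (\<lambda>_. word_pmf \<mu> K))
           (\<lambda>f. (\<Sum>k<K. d (f(i := w)) k)\<^sup>2) \<le> 4 / mu_min * (2 / (1 - exp (- min_info / 2)))\<^sup>2"
proof -
  define P where "P = word_pmf \<mu> K"
  define Q where "Q = Pi_pmf ({..<n} - {i}) [] (\<lambda>_. P)"
  have P: "finite (set_pmf P)" by (simp add: P_def finite_word_pmf)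
  have Q: "finite (set_pmf Q)" unfolding Q_def by (rule finite_set_Pi_pmf) (use P in auto)
  note [simp] = integrable_measure_pmf_finite[OF Q]
  have n: "1 \<le> n" using i by simp
  define b where "b = (\<lambda>k. real n * path_weight i0 (take k u))"
  define s where "s = (\<lambda>k. sqrt (b k))"
  define \<theta> where "\<theta> = (\<lambda>k. if s k \<le> 1 then s k else 1 / s k)"
  have b_pos: "0 < b k" for k using n path_weight_pos by (simp add: b_def)
  have s_pos: "0 < s k" for k using b_pos by (simp add: s_def)
  have s_sq: "(s k)\<^sup>2 = b k" for k using b_pos[of k] by (simp add: s_def less_imp_le)
  have th_pos: "0 < \<theta> k" for k using s_pos by (simp add: \<theta>_def)
  have s_step: "s (Suc k) \<le> exp (- min_info / 2) * s k" if "Suc k < K" for k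
  proof -
    have "b (Suc k) \<le> exp (- min_info) * b k"
      using path_weight_take_Suc[of k u i0] that u by (simp add: b_def mult.left_commute mult_left_mono)
    then have "s (Suc k) \<le> sqrt (exp (- min_info) * b k)" unfolding s_def by simp
    also have "\<dots> = sqrt (exp (- min_info / 2) ^ 2) * s k"
      by (simp add: s_def real_sqrt_mult exp_double[symmetric])
    finally show ?thesis by simp
  qed
  have th_sum: "(\<Sum>k<K. \<theta> k) \<le> 2 / (1 - exp (- min_info / 2))"
    unfolding \<theta>_def by (rule sum_min_inverse_le) (use min_info_pos s_pos s_step in auto)
  have level: "measure_pmf.expectation Q (\<lambda>f. (d (f(i := w)) k)\<^sup>2) \<le> 4 / mu_min * (\<theta> k)\<^sup>2" if k: "k < K" for k
  proof -
    define E where "E = {w'. take (Suc k) w' = i0 # take k u}"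
    define \<pi> where "\<pi> = measure_pmf.prob P E"
    have \<pi>: "\<pi> = \<mu> i0 * path_weight i0 (take k u)"
      unfolding \<pi>_def E_def P_def by (rule prob_take_word) (use k u in auto)
    have \<pi>_pos: "0 < \<pi>" using mu path_weight_pos by (simp add: \<pi>)
    have \<pi>_1: "\<pi> \<le> 1" by (simp add: \<pi>_def)
    have n\<pi>: "real n * \<pi> = \<mu> i0 * b k" by (simp add: \<pi> b_def)
    have N: "card (meets (Suc k) (f(i := w)) {..<n} i) = card {l \<in> {..<n} - {i}. f l \<in> E}" for f
      by (rule arg_cong[where f=card]) (auto simp: meets_def E_def w_def)
    show ?thesis
    proof (cases "1 < b k")
      case True
      have "(d (f(i := w)) k)\<^sup>2 \<le> 2 * (1/2) ^ card {l \<in> {..<n} - {i}. f l \<in> E}" for f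
        using level_count_remove_square(1)[of "{..<n}" i "Suc k" "f(i := w)", unfolded N] i True
        by (simp add: d_def b_def)
      then have "measure_pmf.expectation Q (\<lambda>f. (d (f(i := w)) k)\<^sup>2)
          \<le> measure_pmf.expectation Q (\<lambda>f. 2 * (1/2) ^ card {l \<in> {..<n} - {i}. f l \<in> E})"
        by (intro pmf_expectation_mono Q)
      also have "\<dots> = 2 * (1 - \<pi> / 2) ^ (n - 1)"
        unfolding Q_def using i P by (subst Bochner_Integration.integral_mult_right_zero, subst expectation_half_power_hits) (simp_all add: \<pi>_def)
      also have "\<dots> \<le> 2 * (2 / (real n * \<pi>))"
        by (intro mult_left_mono power_one_minus_half_le \<pi>_pos \<pi>_1 n) simp
      also have "\<dots> = 4 / \<mu> i0 * (1 / b k)" by (simp add: n\<pi>)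
      also have "\<dots> \<le> 4 / mu_min * (1 / b k)"
        using mu_min_le[OF mu] mu_min_pos mu b_pos[of k] by (intro mult_right_mono divide_left_mono) auto
      also have "1 / b k = (\<theta> k)\<^sup>2"
        using True s_sq[of k] by (auto simp: \<theta>_def power_divide s_def)
      finally show ?thesis .
    next
      case False
      have "(d (f(i := w)) k)\<^sup>2 \<le> 4 * real (card {l \<in> {..<n} - {i}. f l \<in> E})" for f
        using level_count_remove_square(2)[of "{..<n}" i "Suc k" "f(i := w)", unfolded N] i False
        by (simp add: d_def b_def)
      then have "measure_pmf.expectation Q (\<lambda>f. (d (f(i := w)) k)\<^sup>2)
          \<le> measure_pmf.expectation Q (\<lambda>f. 4 * real (card {l \<in> {..<n} - {i}. f l \<in> E}))"
        by (intro pmf_expectation_mono Q)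
      also have "\<dots> = 4 * (real (n - 1) * \<pi>)"
        unfolding Q_def using i P by (subst Bochner_Integration.integral_mult_right_zero, subst expectation_card_hits) (simp_all add: \<pi>_def)
      also have "\<dots> \<le> 4 * (real n * \<pi>)" using \<pi>_pos by (simp add: mult_right_mono)
      also have "\<dots> \<le> 4 * b k" unfolding n\<pi> using mu_le_1[of i0] b_pos[of k] by simp
      also have "\<dots> \<le> 4 / mu_min * b k"
        using mu_min_pos mu_min_le_1 b_pos[of k] by (intro mult_right_mono) (auto simp: field_simps)
      also have "b k = (\<theta> k)\<^sup>2"
        using False s_sq[of k] by (auto simp: \<theta>_def s_def)
      finally show ?thesis .
    qed
  qed
  have "measure_pmf.expectation Q (\<lambda>f. (\<Sum>k<K. d (f(i := w)) k)\<^sup>2)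
      \<le> measure_pmf.expectation Q (\<lambda>f. (\<Sum>k<K. \<theta> k) * (\<Sum>k<K. (d (f(i := w)) k)\<^sup>2 / \<theta> k))"
    by (intro pmf_expectation_mono Q square_sum_le_weighted th_pos)
  also have "\<dots> = (\<Sum>k<K. \<theta> k) * (\<Sum>k<K. measure_pmf.expectation Q (\<lambda>f. (d (f(i := w)) k)\<^sup>2) / \<theta> k)"
    by (simp add: Bochner_Integration.integral_sum)
  also have "\<dots> \<le> (\<Sum>k<K. \<theta> k) * (\<Sum>k<K. 4 / mu_min * \<theta> k)"
  proof (intro mult_left_mono sum_mono)
    fix k assume "k \<in> {..<K}"
    then have "measure_pmf.expectation Q (\<lambda>f. (d (f(i := w)) k)\<^sup>2) / \<theta> k \<le> (4 / mu_min * (\<theta> k)\<^sup>2) / \<theta> k"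
      using level[of k] th_pos[of k] by (intro divide_right_mono) auto
    then show "measure_pmf.expectation Q (\<lambda>f. (d (f(i := w)) k)\<^sup>2) / \<theta> k \<le> 4 / mu_min * \<theta> k"
      using th_pos[of k] by (simp add: power2_eq_square)
  qed (rule sum_nonneg[OF less_imp_le[OF th_pos]])
  also have "\<dots> = 4 / mu_min * (\<Sum>k<K. \<theta> k)\<^sup>2"
    unfolding sum_distrib_left[symmetric] power2_eq_square by simp
  also have "\<dots> \<le> 4 / mu_min * (2 / (1 - exp (- min_info / 2)))\<^sup>2"
    using th_sum mu_min_pos by (intro mult_left_mono power_mono sum_nonneg) (auto intro: less_imp_le th_pos)
  finally show ?thesis unfolding Q_def P_def .
qed

text \<open>
  Removing string \<open>i\<close> lowers \<open>level_sum\<close> by \<open>passage\<close> plus a variable with bounded second moment, and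
  \<open>passage + stopped_word / rate\<close> is \<open>T / rate\<close> up to a bounded error. Hence
  the approximation \<open>G i\<close> consists of the sum without string \<open>i\<close> and the constant \<open>T / rate\<close>.
\<close>
theorem variance_level_sum:
  "\<exists>C\<ge>0. \<forall>n K. 1 \<le> n \<longrightarrow> ln (real n) \<le> min_info * real K \<longrightarrow>
     measure_pmf.variance (words_pmf K n)
       (\<lambda>f. level_sum K f {..<n} + (\<Sum>i<n. stopped_word (ln (real n)) (f i)) / rate) \<le> C * real n"
proof -
  obtain C1 where C1: "0 \<le> C1" and
    C1_le: "\<And>T i u. - max_info \<le> T \<Longrightarrow> T \<le> min_info * real (length u) \<Longrightarrow>
     \<bar>stopped_sum T i u - (T - rate * passage T i u)\<bar> \<le> C1"
    using stopped_sum_passage by blast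
  have mi: "0 < max_info" using info_pos[of True True] info_bounds(2)[of True True] by linarith
  define C0 where "C0 = 4 / mu_min * (2 / (1 - exp (- min_info / 2)))\<^sup>2"
  have C0: "0 \<le> C0" using mu_min_pos by (simp add: C0_def)
  show ?thesis
  proof (intro exI[of _ "2 * C0 + 2 * (C1 / rate)\<^sup>2"] conjI allI impI)
    show "0 \<le> 2 * C0 + 2 * (C1 / rate)\<^sup>2" using C0 by simp
    fix n K :: nat assume n: "1 \<le> n" and K: "ln (real n) \<le> min_info * real K"
    define T where "T = ln (real n)"
    have T: "0 \<le> T" "exp T = real n" using n by (auto simp: T_def)
    define F where "F = (\<lambda>f. level_sum K f {..<n} + (\<Sum>i<n. stopped_word T (f i)) / rate)"
    define G where "G = (\<lambda>i f. level_sum K f ({..<n} - {i}) + (\<Sum>j\<in>{..<n} - {i}. stopped_word T (f j)) / rate + T / rate)"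
    have G: "G i (f(i := y)) = G i f" for i f y
    proof -
      have "level_count k (f(i := y)) ({..<n} - {i}) = level_count k f ({..<n} - {i})" for k
        unfolding level_count_def meets_def by (intro arg_cong[where f=card]) auto
      then show ?thesis by (simp add: G_def level_sum_def)
    qed
    have "measure_pmf.variance (words_pmf K n) F
        \<le> (\<Sum>i<n. measure_pmf.expectation (words_pmf K n) (\<lambda>f. (F f - G i f)\<^sup>2))"
      unfolding words_pmf_def by (intro efron_stein_Pi_pmf finite_word_pmf G) simp
    also have "\<dots> \<le> (\<Sum>i<n. 2 * C0 + 2 * (C1 / rate)\<^sup>2)"
    proof (rule sum_mono)
      fix i assume "i \<in> {..<n}"
      then have i: "i < n" by simp
      show "measure_pmf.expectation (words_pmf K n) (\<lambda>f. (F f - G i f)\<^sup>2) \<le> 2 * C0 + 2 * (C1 / rate)\<^sup>2"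
        unfolding words_pmf_def
      proof (rule expectation_Pi_pmf_le[where x = i])
        fix w assume w: "w \<in> set_pmf (word_pmf \<mu> K)"
        then obtain i0 u where wu: "w = i0 # u" "length u = K" by (rule word_pmf_cases)
        have mu: "0 < \<mu> i0"
          using w pmf_word[of u K i0] wu mu_nonneg[of i0] path_weight_pos[of i0 u] by (auto simp: set_pmf_iff less_le)
        let ?Q = "Pi_pmf ({..<n} - {i}) [] (\<lambda>_. word_pmf \<mu> K)"
        have Q: "finite (set_pmf ?Q)" by (rule finite_set_Pi_pmf) (auto simp: finite_word_pmf)
        note [simp] = integrable_measure_pmf_finite[OF Q]
        define d where "d = (\<lambda>(f :: nat \<Rightarrow> bool list) k. real (level_count (Suc k) f {..<n}) - real (level_count (Suc k) f ({..<n} - {i}))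
                       - of_bool (1 < real n * path_weight i0 (take k u)))"
        have diff: "F f - G i f = (\<Sum>k<K. d f k) + (stopped_sum T i0 u - (T - rate * passage T i0 u)) / rate"
          if "f i = w" for f
        proof -
          have "(\<Sum>j<n. stopped_word T (f j)) = stopped_word T (f i) + (\<Sum>j\<in>{..<n} - {i}. stopped_word T (f j))"
            by (rule sum.remove) (use i in auto)
          moreover have "(\<Sum>k<K. d f k) = level_sum K f {..<n} - level_sum K f ({..<n} - {i}) - passage T i0 u"
            using wu(2) by (simp add: d_def level_sum_def sum_subtractf passage_def T(2) del: sum_of_bool_eq)
          ultimately show ?thesis using rate_pos that wu
            by (simp add: F_def G_def stopped_word_def add_divide_distrib diff_divide_distrib)
        qed
        have "(F (f(i := w)) - G i (f(i := w)))\<^sup>2 \<le> 2 * (\<Sum>k<K. d (f(i := w)) k)\<^sup>2 + 2 * (C1 / rate)\<^sup>2" for f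
        proof -
          define x y where "x = (\<Sum>k<K. d (f(i := w)) k)" and "y = (stopped_sum T i0 u - (T - rate * passage T i0 u)) / rate"
          have "\<bar>y\<bar> \<le> C1 / rate"
            using C1_le[of T u i0] T(1) mi K wu(2) rate_pos by (simp add: y_def T_def divide_right_mono)
          then have "y\<^sup>2 \<le> (C1 / rate)\<^sup>2" by (rule abs_le_square_iff[THEN iffD1, OF order.trans]) (use C1 rate_pos in simp)
          moreover have "(x + y)\<^sup>2 \<le> 2 * x\<^sup>2 + 2 * y\<^sup>2"
            using zero_le_power2[of "x - y"] by (simp add: power2_eq_square algebra_simps)
          ultimately show ?thesis using diff[of "f(i := w)"] by (simp add: x_def y_def)
        qed
        then have "measure_pmf.expectation ?Q (\<lambda>f. (F (f(i := w)) - G i (f(i := w)))\<^sup>2)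
            \<le> measure_pmf.expectation ?Q (\<lambda>f. 2 * (\<Sum>k<K. d (f(i := w)) k)\<^sup>2 + 2 * (C1 / rate)\<^sup>2)"
          by (intro pmf_expectation_mono Q)
        also have "\<dots> = 2 * measure_pmf.expectation ?Q (\<lambda>f. (\<Sum>k<K. d (f(i := w)) k)\<^sup>2) + 2 * (C1 / rate)\<^sup>2"
          by (simp add: measure_pmf.prob_space)
        also have "\<dots> \<le> 2 * C0 + 2 * (C1 / rate)\<^sup>2"
          using removal_second_moment[OF i wu(2) mu] unfolding d_def wu(1) C0_def by simp
        finally show "measure_pmf.expectation ?Q (\<lambda>f. (F (f(i := w)) - G i (f(i := w)))\<^sup>2) \<le> 2 * C0 + 2 * (C1 / rate)\<^sup>2" .
      qed (use i in \<open>auto simp: finite_word_pmf\<close>)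
    qed
    also have "\<dots> = (2 * C0 + 2 * (C1 / rate)\<^sup>2) * real n" by simp
    finally show "measure_pmf.variance (words_pmf K n)
       (\<lambda>f. level_sum K f {..<n} + (\<Sum>i<n. stopped_word (ln (real n)) (f i)) / rate)
       \<le> (2 * C0 + 2 * (C1 / rate)\<^sup>2) * real n" by (simp add: F_def T_def)
  qed
qed

end

section \<open>The limit law of the stopped sums\<close>

lemma char_distr_pmf_near_gaussian:
  fixes X :: "'b \<Rightarrow> real"
  assumes P: "finite (set_pmf P)" and mean: "measure_pmf.expectation P X = 0"
    and bound: "\<And>w. w \<in> set_pmf P \<Longrightarrow> \<bar>X w\<bar> \<le> B"
  defines "v \<equiv> measure_pmf.expectation P (\<lambda>w. (X w)\<^sup>2)"
  shows "cmod (char (distr P borel X) t - (1 - t\<^sup>2 * v / 2)) \<le> \<bar>t\<bar>^3 / 6 * (B * v)"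
proof -
  note [simp] = integrable_measure_pmf_finite[OF P]
  have "cmod (char (distr P borel X) t - (1 - t\<^sup>2 * v / 2))
      \<le> t\<^sup>2 / 6 * measure_pmf.expectation P (\<lambda>w. min (6 * (X w)\<^sup>2) (\<bar>t\<bar> * \<bar>X w\<bar>^3))"
    by (rule prob_space.char_approx3'[OF prob_space_measure_pmf]) (simp_all add: mean v_def)
  also have "\<dots> \<le> t\<^sup>2 / 6 * measure_pmf.expectation P (\<lambda>w. \<bar>t\<bar> * B * (X w)\<^sup>2)"
  proof (intro mult_left_mono pmf_expectation_mono P)
    fix w assume "w \<in> set_pmf P"
    then have "\<bar>t\<bar> * (\<bar>X w\<bar> * (X w)\<^sup>2) \<le> \<bar>t\<bar> * (B * (X w)\<^sup>2)"
      by (intro mult_left_mono mult_right_mono bound) auto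
    moreover have "\<bar>X w\<bar>^3 = \<bar>X w\<bar> * (X w)\<^sup>2" by (simp add: power3_eq_cube power2_eq_square abs_mult_self_eq mult.assoc)
    ultimately show "min (6 * (X w)\<^sup>2) (\<bar>t\<bar> * \<bar>X w\<bar>^3) \<le> \<bar>t\<bar> * B * (X w)\<^sup>2" by (simp add: min.coboundedI2 mult.assoc)
  qed simp
  also have "\<dots> = \<bar>t\<bar>^3 / 6 * (B * v)"
  proof -
    have "t\<^sup>2 * \<bar>t\<bar> = \<bar>t\<bar>^3" by (simp add: power3_eq_cube power2_eq_square)
    then show ?thesis by (simp add: v_def)
  qed
  finally show ?thesis .
qed

text \<open>
  The central limit theorem for row-wise identically distributed arrays under a Lyapunov condition. It
  is stated for characteristic functions, the form in which the row sums are later compared with random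
  variables on other probability spaces.
\<close>
theorem char_row_sums_tendsto:
  fixes W :: "nat \<Rightarrow> 'b \<Rightarrow> real"
  assumes P: "\<And>n. finite (set_pmf (P n))" and mean: "\<And>n. measure_pmf.expectation (P n) (W n) = 0"
    and bound: "\<And>n w. w \<in> set_pmf (P n) \<Longrightarrow> \<bar>W n w\<bar> \<le> B n"
  defines "v \<equiv> \<lambda>n. measure_pmf.expectation (P n) (\<lambda>w. (W n w)\<^sup>2)"
  assumes lim_var: "(\<lambda>n. real n * (c n)\<^sup>2 * v n) \<longlonglongrightarrow> s"
    and lim_third: "(\<lambda>n. real n * \<bar>c n\<bar>^3 * B n * v n) \<longlonglongrightarrow> 0" and s: "0 \<le> s"
  shows "(\<lambda>n. char (distr (Pi_pmf {..<n} d (\<lambda>_. P n)) borel (\<lambda>f. c n * (\<Sum>i<n. W n (f i)))) t)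
     \<longlonglongrightarrow> exp (- (s * t\<^sup>2 / 2))"
proof -
  define \<phi> where "\<phi> n = char (distr (P n) borel (\<lambda>w. c n * W n w)) t" for n
  define a where "a = s * t\<^sup>2 / 2"
  have rows: "char (distr (Pi_pmf {..<n} d (\<lambda>_. P n)) borel (\<lambda>f. c n * (\<Sum>i<n. W n (f i)))) t = \<phi> n ^ n" for n
  proof -
    let ?Q = "Pi_pmf {..<n} d (\<lambda>_. P n)"
    have "prob_space.indep_vars ?Q (\<lambda>_. borel) (\<lambda>i f. c n * W n (f i)) {..<n}"
      by (rule prob_space.indep_vars_compose2[OF prob_space_measure_pmf indep_vars_Pi_pmf]) auto
    then have "char (distr ?Q borel (\<lambda>f. \<Sum>i<n. c n * W n (f i))) t = (\<Prod>i<n. char (distr ?Q borel (\<lambda>f. c n * W n (f i))) t)"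
      by (rule prob_space.char_distr_sum[OF prob_space_measure_pmf])
    also have "\<dots> = (\<Prod>i<n. \<phi> n)"
    proof (rule prod.cong)
      fix i assume "i \<in> {..<n}"
      then have "map_pmf (\<lambda>f. f i) ?Q = P n" by (subst Pi_pmf_component) auto
      then have "distr (P n) borel (\<lambda>w. c n * W n w) = distr (map_pmf (\<lambda>f. f i) ?Q) borel (\<lambda>w. c n * W n w)" by simp
      also have "\<dots> = distr ?Q borel (\<lambda>f. c n * W n (f i))"
        unfolding map_pmf_rep_eq by (subst distr_distr) (auto simp: o_def)
      finally show "char (distr ?Q borel (\<lambda>f. c n * W n (f i))) t = \<phi> n" by (simp add: \<phi>_def)
    qed simp
    finally show ?thesis by (simp add: sum_distrib_left)
  qed
  have \<phi>_1: "cmod (\<phi> n) \<le> 1" for n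
    unfolding \<phi>_def by (intro real_distribution.cmod_char_le_1) (simp add: prob_space.real_distribution_distr[OF prob_space_measure_pmf])
  have approx: "cmod (\<phi> n - (1 - t\<^sup>2 * ((c n)\<^sup>2 * v n) / 2)) \<le> \<bar>t\<bar>^3 / 6 * (\<bar>c n\<bar> * B n * ((c n)\<^sup>2 * v n))" for n
  proof -
    have "\<bar>c n * W n w\<bar> \<le> \<bar>c n\<bar> * B n" if "w \<in> set_pmf (P n)" for w
      using bound[OF that] by (simp add: abs_mult mult_left_mono)
    from char_distr_pmf_near_gaussian[OF P[of n] _ this, where t = t] show ?thesis
      by (simp add: \<phi>_def v_def mean power_mult_distrib)
  qed
  have main: "eventually (\<lambda>n. cmod (\<phi> n ^ n - complex_of_real ((1 - a / n) ^ n))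
      \<le> \<bar>t\<bar>^3 / 6 * (real n * \<bar>c n\<bar>^3 * B n * v n) + t\<^sup>2 / 2 * \<bar>real n * (c n)\<^sup>2 * v n - s\<bar>) sequentially"
  proof (rule eventually_sequentiallyI)
    fix n :: nat assume n: "nat \<lceil>a\<rceil> + 1 \<le> n"
    have "real (nat \<lceil>a\<rceil>) \<ge> a" by linarith
    then have n': "a \<le> real n" "0 < real n" using n by linarith+
    have a: "0 \<le> a" using s by (simp add: a_def)
    have "cmod (complex_of_real (1 - a / n)) \<le> 1"
      unfolding norm_of_real using n' a by (simp add: abs_le_iff field_simps)
    then have "cmod (\<phi> n ^ n - complex_of_real (1 - a / n) ^ n) \<le> n * cmod (\<phi> n - complex_of_real (1 - a / n))"
      by (intro norm_power_diff \<phi>_1)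
    also have "cmod (\<phi> n - complex_of_real (1 - a / n))
        \<le> cmod (\<phi> n - (1 - t\<^sup>2 * ((c n)\<^sup>2 * v n) / 2)) + cmod (complex_of_real (a / n - t\<^sup>2 * ((c n)\<^sup>2 * v n) / 2))"
      by (rule order.trans[OF _ norm_triangle_ineq]) (simp add: algebra_simps)
    also have "\<dots> \<le> \<bar>t\<bar>^3 / 6 * (\<bar>c n\<bar> * B n * ((c n)\<^sup>2 * v n)) + \<bar>a / n - t\<^sup>2 * ((c n)\<^sup>2 * v n) / 2\<bar>"
      using approx[of n] unfolding norm_of_real by (rule add_right_mono)
    also have "n * \<dots> = \<bar>t\<bar>^3 / 6 * (real n * \<bar>c n\<bar>^3 * B n * v n) + t\<^sup>2 / 2 * \<bar>real n * (c n)\<^sup>2 * v n - s\<bar>"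
    proof -
      have "real n * (\<bar>t\<bar>^3 / 6 * (\<bar>c n\<bar> * B n * ((c n)\<^sup>2 * v n))) = \<bar>t\<bar>^3 / 6 * (real n * \<bar>c n\<bar>^3 * B n * v n)"
        by (simp add: power3_eq_cube[of "\<bar>c n\<bar>"] power2_eq_square)
      moreover have "real n * \<bar>a / n - t\<^sup>2 * ((c n)\<^sup>2 * v n) / 2\<bar> = \<bar>real n * (a / n - t\<^sup>2 * ((c n)\<^sup>2 * v n) / 2)\<bar>"
        using n' by (simp add: abs_mult)
      moreover have "real n * (a / n - t\<^sup>2 * ((c n)\<^sup>2 * v n) / 2) = - (t\<^sup>2 / 2 * (real n * (c n)\<^sup>2 * v n - s))"
        using n' by (simp add: a_def field_simps)
      moreover have "\<bar>- (t\<^sup>2 / 2 * (real n * (c n)\<^sup>2 * v n - s))\<bar> = t\<^sup>2 / 2 * \<bar>real n * (c n)\<^sup>2 * v n - s\<bar>"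
        by (simp only: abs_minus_cancel abs_mult) simp
      ultimately show ?thesis by (simp only: distrib_left)
    qed
    finally show "cmod (\<phi> n ^ n - complex_of_real ((1 - a / n) ^ n))
      \<le> \<bar>t\<bar>^3 / 6 * (real n * \<bar>c n\<bar>^3 * B n * v n) + t\<^sup>2 / 2 * \<bar>real n * (c n)\<^sup>2 * v n - s\<bar>"
      using n' by (simp add: mult_left_mono)
  qed
  have "(\<lambda>n. \<bar>t\<bar>^3 / 6 * (real n * \<bar>c n\<bar>^3 * B n * v n) + t\<^sup>2 / 2 * \<bar>real n * (c n)\<^sup>2 * v n - s\<bar>)
      \<longlonglongrightarrow> \<bar>t\<bar>^3 / 6 * 0 + t\<^sup>2 / 2 * \<bar>s - s\<bar>"
    by (intro tendsto_intros lim_var lim_third)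
  then have lim0: "(\<lambda>n. \<bar>t\<bar>^3 / 6 * (real n * \<bar>c n\<bar>^3 * B n * v n) + t\<^sup>2 / 2 * \<bar>real n * (c n)\<^sup>2 * v n - s\<bar>) \<longlonglongrightarrow> 0"
    by simp
  have "(\<lambda>n. (1 + (- a) / n) ^ n) \<longlonglongrightarrow> exp (- a)"
    by (rule tendsto_exp_limit_sequentially)
  then have "(\<lambda>n. complex_of_real ((1 - a / n) ^ n)) \<longlonglongrightarrow> complex_of_real (exp (- a))"
    by (intro tendsto_of_real) simp
  then have "(\<lambda>n. \<phi> n ^ n) \<longlonglongrightarrow> complex_of_real (exp (- a))"
    by (rule Lim_transform) (rule Lim_null_comparison[OF main lim0])
  then show ?thesis unfolding rows a_def .
qed

context markov_words
begin

lemma stopped_word_mean: "measure_pmf.expectation (word_pmf \<mu> K) (stopped_word T) = 0"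
  by (simp add: expectation_word stopped_word_def expectation_stopped_sum)

lemma stopped_word_second_moment:
  "\<exists>C\<ge>0. \<forall>T K. 0 \<le> T \<longrightarrow> T \<le> min_info * real K \<longrightarrow>
     \<bar>measure_pmf.expectation (word_pmf \<mu> K) (\<lambda>w. (stopped_word T w)\<^sup>2) - stopped_rate * T\<bar> \<le> C"
proof -
  obtain C where C: "0 \<le> C" and le: "\<And>T k i. - max_info \<le> T \<Longrightarrow> T \<le> min_info * real k \<Longrightarrow>
     \<bar>measure_pmf.expectation (path_pmf k i) (\<lambda>u. (stopped_sum T i u)\<^sup>2) - stopped_rate * T\<bar> \<le> C"
    using stopped_sum_second_moment by blast
  have mi: "0 < max_info" using info_pos[of True True] info_bounds(2)[of True True] by linarith
  show ?thesis
  proof (intro exI[of _ C] conjI allI impI C)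
    fix T K assume T: "0 \<le> T" "T \<le> min_info * real K"
    define x where "x i = measure_pmf.expectation (path_pmf K i) (\<lambda>u. (stopped_sum T i u)\<^sup>2) - stopped_rate * T" for i
    have x: "\<bar>x i\<bar> \<le> C" for i unfolding x_def by (rule le) (use T mi in auto)
    have "measure_pmf.expectation (word_pmf \<mu> K) (\<lambda>w. (stopped_word T w)\<^sup>2) - stopped_rate * T
        = \<mu> False * (x False + stopped_rate * T) + \<mu> True * (x True + stopped_rate * T) - (\<mu> False + \<mu> True) * (stopped_rate * T)"
      by (simp add: expectation_word stopped_word_def x_def mu_sum)
    also have "\<dots> = \<mu> False * x False + \<mu> True * x True" by (simp add: algebra_simps)
    also have "\<bar>\<dots>\<bar> \<le> \<mu> False * \<bar>x False\<bar> + \<mu> True * \<bar>x True\<bar>"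
      using mu_nonneg by (intro order.trans[OF abs_triangle_ineq]) (simp add: abs_mult)
    also have "\<dots> \<le> \<mu> False * C + \<mu> True * C"
      using mu_nonneg x by (intro add_mono mult_left_mono)
    also have "\<dots> = C" using mu_sum by (simp flip: distrib_right)
    finally show "\<bar>measure_pmf.expectation (word_pmf \<mu> K) (\<lambda>w. (stopped_word T w)\<^sup>2) - stopped_rate * T\<bar> \<le> C" .
  qed
qed

theorem char_stopped_sums_tendsto:
  assumes K: "\<And>n. ln (real n) \<le> min_info * real (K n)"
  shows "(\<lambda>n. char (distr (words_pmf (K n) n) borel
       (\<lambda>f. (- 1 / (rate * sqrt (real n * ln (real n)))) * (\<Sum>i<n. stopped_word (ln (real n)) (f i)))) t)
     \<longlonglongrightarrow> exp (- (stopped_rate / rate\<^sup>2 * t\<^sup>2 / 2))"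
proof -
  obtain B where B: "0 \<le> B" "\<And>T i u. 0 \<le> T \<Longrightarrow> \<bar>stopped_sum T i u\<bar> \<le> B * (1 + T)"
    using stopped_sum_bound by blast
  obtain C where C: "0 \<le> C" "\<And>T K. 0 \<le> T \<Longrightarrow> T \<le> min_info * real K \<Longrightarrow>
     \<bar>measure_pmf.expectation (word_pmf \<mu> K) (\<lambda>w. (stopped_word T w)\<^sup>2) - stopped_rate * T\<bar> \<le> C"
    using stopped_word_second_moment by blast
  have ln: "0 \<le> ln (real n)" for n :: nat by (cases "n = 0") auto
  define v where "v = (\<lambda>n. measure_pmf.expectation (word_pmf \<mu> (K n)) (\<lambda>w. (stopped_word (ln (real n)) w)\<^sup>2))"
  have v: "\<bar>v n - stopped_rate * ln (real n)\<bar> \<le> C" for n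
    unfolding v_def by (rule C(2)[OF ln K])
  have fin: "finite (set_pmf (word_pmf \<mu> (K n)))" for n by (rule finite_word_pmf)
  have mean: "measure_pmf.expectation (word_pmf \<mu> (K n)) (stopped_word (ln (real n))) = 0" for n
    by (rule stopped_word_mean)
  have bound: "\<bar>stopped_word (ln (real n)) w\<bar> \<le> B * (1 + ln (real n))" for n w
    unfolding stopped_word_def by (rule B(2)[OF ln])
  have lim: "(\<lambda>n. v n / ln (real n)) \<longlonglongrightarrow> stopped_rate"
  proof -
    have "(\<lambda>n. C / ln (real n)) \<longlonglongrightarrow> 0" by real_asymp
    moreover have "eventually (\<lambda>n. norm (v n / ln (real n) - stopped_rate) \<le> C / ln (real n)) sequentially"
    proof (rule eventually_sequentiallyI[of 2])
      fix n :: nat assume "2 \<le> n"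
      then have l: "0 < ln (real n)" by simp
      then have "v n / ln (real n) - stopped_rate = (v n - stopped_rate * ln (real n)) / ln (real n)" by (simp add: field_simps)
      then show "norm (v n / ln (real n) - stopped_rate) \<le> C / ln (real n)"
        using v[of n] l by (simp add: divide_right_mono)
    qed
    ultimately have "(\<lambda>n. v n / ln (real n) - stopped_rate) \<longlonglongrightarrow> 0" by (rule Lim_null_comparison[rotated])
    then show ?thesis by (simp add: LIM_zero_iff)
  qed
  define c where "c = (\<lambda>n. - 1 / (rate * sqrt (real n * ln (real n))))"
  have c2: "real n * (c n)\<^sup>2 * v n = v n / ln (real n) / rate\<^sup>2" if "2 \<le> n" for n
  proof -
    have "0 < ln (real n)" using that by simp
    then show ?thesis using rate_pos that by (simp add: c_def power_divide power_mult_distrib field_simps)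
  qed
  have "(\<lambda>n. v n / ln (real n) / rate\<^sup>2) \<longlonglongrightarrow> stopped_rate / rate\<^sup>2"
    by (intro tendsto_divide lim tendsto_const) (use rate_pos in simp)
  then have "(\<lambda>n. real n * (c n)\<^sup>2 * v n) \<longlonglongrightarrow> stopped_rate / rate\<^sup>2"
    by (rule Lim_transform_eventually) (use c2 in \<open>auto intro!: eventually_sequentiallyI[of 2]\<close>)
  then have lim_var: "(\<lambda>n. real n * (- 1 / (rate * sqrt (real n * ln (real n))))\<^sup>2
      * measure_pmf.expectation (word_pmf \<mu> (K n)) (\<lambda>w. (stopped_word (ln (real n)) w)\<^sup>2)) \<longlonglongrightarrow> stopped_rate / rate\<^sup>2"
    unfolding c_def v_def .
  have "(\<lambda>n. (v n / ln (real n)) * (B / rate^3) * (real n * (1 + ln (real n)) * ln (real n) / sqrt (real n * ln (real n)) ^ 3))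
      \<longlonglongrightarrow> stopped_rate * (B / rate^3) * 0"
  proof (intro tendsto_mult lim tendsto_const)
    show "(\<lambda>n. real n * (1 + ln (real n)) * ln (real n) / sqrt (real n * ln (real n)) ^ 3) \<longlonglongrightarrow> 0" by real_asymp
  qed
  then have "(\<lambda>n. real n * \<bar>c n\<bar>^3 * (B * (1 + ln (real n))) * v n) \<longlonglongrightarrow> stopped_rate * (B / rate^3) * 0"
  proof (rule Lim_transform_eventually, intro eventually_sequentiallyI[of 2])
    fix n :: nat assume n: "2 \<le> n"
    define l S where "l = ln (real n)" and "S = sqrt (real n * l)"
    have l: "0 < l" "0 < S" using n by (auto simp: l_def S_def)
    have "\<bar>c n\<bar> = 1 / (rate * S)" using rate_pos l(2) by (simp add: c_def l_def[symmetric] S_def[symmetric] abs_mult)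
    then have cn: "\<bar>c n\<bar>^3 = 1 / (rate^3 * S^3)" by (simp add: power_divide power_mult_distrib)
    show "(v n / ln (real n)) * (B / rate^3) * (real n * (1 + ln (real n)) * ln (real n) / sqrt (real n * ln (real n)) ^ 3)
        = real n * \<bar>c n\<bar>^3 * (B * (1 + ln (real n))) * v n"
      using l rate_pos unfolding cn l_def[symmetric] S_def[symmetric] by (simp add: field_simps)
  qed
  then have lim_third: "(\<lambda>n. real n * \<bar>- 1 / (rate * sqrt (real n * ln (real n)))\<bar>^3 * (B * (1 + ln (real n)))
      * measure_pmf.expectation (word_pmf \<mu> (K n)) (\<lambda>w. (stopped_word (ln (real n)) w)\<^sup>2)) \<longlonglongrightarrow> 0"
    unfolding c_def v_def by simp
  have "0 \<le> incr_var i" for i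
    using p_pos[of i] by (simp add: incr_var_def step_mean_def less_imp_le)
  then have s: "0 \<le> stopped_rate / rate\<^sup>2" using p_pos rate_pos
    by (simp add: stopped_rate_def var_rate_def stationary_mean_def less_imp_le)
  show ?thesis
    unfolding words_pmf_def by (rule char_row_sums_tendsto[OF fin mean bound lim_var lim_third s])
qed

end

section \<open>From the streams to finite words\<close>

lemma (in binary_chain) path_weight_le: "path_weight i u \<le> exp (- min_info) ^ length u"
  by (induction u arbitrary: i)
    (auto intro!: mult_mono p_le path_weight_pos[THEN less_imp_le])

definition shares_prefix :: "nat \<Rightarrow> nat \<Rightarrow> (nat \<Rightarrow> 'a stream) \<Rightarrow> nat \<Rightarrow> bool" where
  "shares_prefix n k s i \<longleftrightarrow> (\<exists>j<n. j \<noteq> i \<and> stake k (s j) = stake k (s i))"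

definition sharing_count :: "nat \<Rightarrow> nat \<Rightarrow> (nat \<Rightarrow> 'a stream) \<Rightarrow> nat" where
  "sharing_count n k s = card {i. i < n \<and> shares_prefix n k s i}"

lemma stake_eq_mono: "k \<le> k' \<Longrightarrow> stake k' s = stake k' t \<Longrightarrow> stake k s = stake k t"
  using take_stake[of k k' s] take_stake[of k k' t] by (simp add: min_absorb1)

lemma shares_prefix_mono: "k \<le> k' \<Longrightarrow> shares_prefix n k' s i \<Longrightarrow> shares_prefix n k s i"
  unfolding shares_prefix_def by (blast intro: stake_eq_mono)

lemma stake_in_path_nodes: "stake k s \<in> path_nodes t \<longleftrightarrow> stake k s = stake k t"
proof
  assume "stake k s \<in> path_nodes t"
  then obtain k' where "stake k s = stake k' t" by (auto simp: path_nodes_def)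
  then show "stake k s = stake k t" by (metis length_stake)
qed (auto simp: path_nodes_def)

text \<open>
  If string \<open>i\<close> coincides with another one, no node qualifies, and the choice made by \<open>ARG_MIN\<close> does not
  depend on the strings; this fixed value is what makes the path length measurable everywhere.
\<close>
lemma trie_node_cases:
  "length (trie_node n s i) =
    (if \<exists>k. \<not> shares_prefix n k s i then LEAST k. \<not> shares_prefix n k s i
     else length (ARG_MIN length v. False :: bool list))"
proof -
  define P where "P = (\<lambda>v. v \<in> path_nodes (s i) \<and> (\<forall>j<n. j \<noteq> i \<longrightarrow> v \<notin> path_nodes (s j)))"
  have P_iff: "P v \<longleftrightarrow> (\<exists>k. v = stake k (s i) \<and> \<not> shares_prefix n k s i)" for v
  proof
    assume "P v"
    then obtain k where v: "v = stake k (s i)" by (auto simp: P_def path_nodes_def)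
    have "\<not> shares_prefix n k s i"
      using \<open>P v\<close> unfolding v P_def shares_prefix_def stake_in_path_nodes by metis
    with v show "\<exists>k. v = stake k (s i) \<and> \<not> shares_prefix n k s i" by blast
  next
    assume "\<exists>k. v = stake k (s i) \<and> \<not> shares_prefix n k s i"
    then show "P v" by (auto simp: P_def shares_prefix_def stake_in_path_nodes)
  qed
  have t: "trie_node n s i = arg_min length P" by (simp add: trie_node_def P_def)
  show ?thesis
  proof (cases "\<exists>k. \<not> shares_prefix n k s i")
    case True
    then obtain k where k: "P (stake k (s i))" by (auto simp: P_iff)
    have "length (arg_min length P) = (LEAST k. \<not> shares_prefix n k s i)"
    proof (rule Least_equality[symmetric])
      have "P (arg_min length P)" using arg_min_nat_lemma[of P, OF k] by blast
      then show "\<not> shares_prefix n (length (arg_min length P)) s i" unfolding P_iff by auto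
      fix k assume "\<not> shares_prefix n k s i"
      then have "P (stake k (s i))" by (auto simp: P_iff)
      then show "length (arg_min length P) \<le> k" using arg_min_nat_le[of P "stake k (s i)" length] by simp
    qed
    then show ?thesis using True by (simp add: t)
  next
    case False
    then have "P = (\<lambda>_. False)" by (auto simp: P_iff)
    then show ?thesis using False by (simp add: t)
  qed
qed

text \<open>
  Sharing is inherited by shorter prefixes, so the depth of a string is the number of depths at which
  its node is shared. Exchanging the two summations sorts the external path length by depth.
\<close>
lemma external_path_length_eq_sum:
  assumes "\<And>k. k0 \<le> k \<Longrightarrow> sharing_count n k s = 0"
  shows "real (external_path_length n s) = (\<Sum>k<k0. real (sharing_count n k s))"
proof -
  have none: "\<not> shares_prefix n k0 s i" if "i < n" for i
    using assms[of k0] that by (simp add: sharing_count_def)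
  have len: "length (trie_node n s i) = card {k \<in> {..<k0}. shares_prefix n k s i}" if i: "i < n" for i
  proof -
    define m where "m = (LEAST k. \<not> shares_prefix n k s i)"
    have m: "\<not> shares_prefix n m s i" unfolding m_def by (rule LeastI[of _ k0]) (rule none[OF i])
    have "m \<le> k0" unfolding m_def by (rule Least_le) (rule none[OF i])
    have iff: "shares_prefix n k s i \<longleftrightarrow> k < m" for k
      using m shares_prefix_mono[of m k n s i] not_less_Least[of k "\<lambda>k. \<not> shares_prefix n k s i", folded m_def]
      by (cases "k < m") auto
    have "{k \<in> {..<k0}. shares_prefix n k s i} = {..<m}" using \<open>m \<le> k0\<close> by (auto simp: iff)
    moreover have "length (trie_node n s i) = m"
      unfolding trie_node_cases using none[OF i] by (auto simp: m_def)
    ultimately show ?thesis by simp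
  qed
  have "external_path_length n s = (\<Sum>i<n. \<Sum>k<k0. of_bool (shares_prefix n k s i))"
    unfolding external_path_length_def by (intro sum.cong) (auto simp: len Int_def)
  also have "\<dots> = (\<Sum>k<k0. \<Sum>i<n. of_bool (shares_prefix n k s i))" by (rule sum.swap)
  also have "\<dots> = (\<Sum>k<k0. sharing_count n k s)"
    by (intro sum.cong) (auto simp: sharing_count_def Int_def)
  finally show ?thesis by simp
qed

lemma sharing_count_level_count:
  fixes s :: "nat \<Rightarrow> 'a stream"
  assumes "k \<le> K"
  shows "sharing_count n k s = level_count k (\<lambda>i. if i < n then stake K (s i) else []) {..<n}"
proof -
  have "take k (stake K t) = stake k t" for t :: "'a stream" using assms by (simp add: take_stake min_absorb1)
  then show ?thesis unfolding sharing_count_def level_count_def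
    by (intro arg_cong[where f=card]) (auto simp: shares_prefix_def meets_def)
qed

locale trie_model = markov_words p \<mu> + prob_space M for p \<mu> and M :: "'a measure" +
  fixes n :: nat and X :: "nat \<Rightarrow> 'a \<Rightarrow> bool stream"
  assumes n_pos: "1 \<le> n" and source: "markov_source M \<mu> p n X"
begin

lemma X_measurable [measurable]: "i < n \<Longrightarrow> X i \<in> measurable M (stream_space (count_space UNIV))"
  using source by (auto simp: markov_source_def markov_chain_def)

lemma stake_X_measurable [measurable]: "i < n \<Longrightarrow> (\<lambda>\<omega>. stake k (X i \<omega>)) \<in> measurable M (count_space UNIV)"
  by (rule measurable_compose[OF X_measurable measurable_stake])

lemma stake_event: "i < n \<Longrightarrow> {\<omega> \<in> space M. stake k (X i \<omega>) = w} \<in> events"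
  by (rule measurable_sets_Collect[OF stake_X_measurable]) auto

lemma prob_prefix:
  assumes i: "i < n"
  shows "prob {\<omega> \<in> space M. stake (Suc (length u)) (X i \<omega>) = a # u} = \<mu> a * path_weight a u"
proof (induction u rule: rev_induct)
  case Nil
  have "prob {\<omega> \<in> space M. X i \<omega> !! 0 = a} = \<mu> a"
    using source i by (auto simp: markov_source_def markov_chain_def)
  then show ?case by simp
next
  case (snoc j u)
  let ?w = "a # u"
  let ?A = "{\<omega> \<in> space M. stake (length ?w) (X i \<omega>) = ?w}"
  let ?B = "{\<omega> \<in> space M. X i \<omega> !! length ?w = j \<and> stake (length ?w) (X i \<omega>) = ?w}"
  have eq: "{\<omega> \<in> space M. stake (Suc (length (u @ [j]))) (X i \<omega>) = a # u @ [j]} = ?B"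
  proof -
    have "stake (Suc (length ?w)) t = ?w @ [j] \<longleftrightarrow> t !! length ?w = j \<and> stake (length ?w) t = ?w" for t
      unfolding stake_Suc[of "length ?w"] append_eq_append_conv[of "stake (length ?w) t" ?w] by auto
    then show ?thesis by auto
  qed
  have A: "prob ?A = \<mu> a * path_weight a u" using snoc by simp
  have "prob ?B = prob ?A * p (last ?w) j"
  proof (cases "prob ?A = 0")
    \<comment> \<open>the Markov property is silent about histories of probability \<open>0\<close>; both sides vanish\<close>
    case True
    have "prob ?B \<le> prob ?A"
    proof (rule finite_measure_mono)
      show "?A \<in> events" by (rule stake_event[OF i])
    qed auto
    then have "prob ?B = 0" unfolding True using measure_nonneg[of M ?B] by (rule order.antisym)
    then show ?thesis unfolding True by simp
  next
    case False
    then have "0 < prob ?A" by (simp add: less_le)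
    moreover have "?w \<noteq> []" by simp
    ultimately have "cond_prob M (\<lambda>\<omega>. X i \<omega> !! length ?w = j) (\<lambda>\<omega>. stake (length ?w) (X i \<omega>) = ?w) = p (last ?w) j"
      using source i unfolding markov_source_def markov_chain_def by blast
    then show ?thesis using False unfolding cond_prob_def by (simp add: field_simps)
  qed
  then show ?case unfolding eq A path_weight_snoc by (simp only: mult.assoc)
qed

text \<open>The value outside of \<open>{..<n}\<close> is the default value of \<open>words_pmf\<close>.\<close>
definition words :: "nat \<Rightarrow> 'a \<Rightarrow> nat \<Rightarrow> bool list" where
  "words K \<omega> i = (if i < n then stake (Suc K) (X i \<omega>) else [])"

lemma prob_words:
  assumes f: "\<And>i. i < n \<Longrightarrow> length (f i) = Suc K" "\<And>i. n \<le> i \<Longrightarrow> f i = []"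
  shows "{\<omega> \<in> space M. words K \<omega> = f} \<in> events"
    and "prob {\<omega> \<in> space M. words K \<omega> = f} = pmf (words_pmf K n) f"
proof -
  have "0 \<in> {..<n}" using n_pos by simp
  then have ne: "{..<n} \<noteq> {}" by blast
  have "words K \<omega> = f \<longleftrightarrow> (\<forall>i<n. stake (Suc K) (X i \<omega>) = f i)" for \<omega>
  proof
    assume *: "\<forall>i<n. stake (Suc K) (X i \<omega>) = f i"
    show "words K \<omega> = f"
    proof
      show "words K \<omega> i = f i" for i
        using * f(2)[of i] by (cases "i < n") (simp_all add: words_def del: stake.simps)
    qed
  next
    assume "words K \<omega> = f"
    then show "\<forall>i<n. stake (Suc K) (X i \<omega>) = f i" by (auto simp: words_def simp del: stake.simps)
  qed
  then have eq: "{\<omega> \<in> space M. words K \<omega> = f} = (\<Inter>i\<in>{..<n}. X i -` {s. stake (Suc K) s = f i} \<inter> space M)"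
    using ne by blast
  have set: "{s. stake (Suc K) s = f i} \<in> sets (stream_space (count_space UNIV))" for i
  proof -
    have "stake (Suc K) -` {f i} \<inter> space (stream_space (count_space UNIV)) \<in> sets (stream_space (count_space UNIV))"
      by (rule measurable_sets[OF measurable_stake]) simp
    then show ?thesis by (simp add: vimage_def space_stream_space)
  qed
  have pre: "X i -` {s. stake (Suc K) s = f i} \<inter> space M = {\<omega> \<in> space M. stake (Suc K) (X i \<omega>) = f i}" for i
    by auto
  show "{\<omega> \<in> space M. words K \<omega> = f} \<in> events"
    unfolding eq using ne by (intro sets.finite_INT) (auto simp: pre intro!: stake_event)
  have "prob (\<Inter>i\<in>{..<n}. X i -` {s. stake (Suc K) s = f i} \<inter> space M)
      = (\<Prod>i<n. prob (X i -` {s. stake (Suc K) s = f i} \<inter> space M))"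
    using source ne by (intro indep_varsD_finite[where M' = "\<lambda>_. stream_space (count_space UNIV)"] set)
      (auto simp: markov_source_def)
  also have "\<dots> = (\<Prod>i<n. pmf (word_pmf \<mu> K) (f i))"
  proof (intro prod.cong refl)
    fix i assume "i \<in> {..<n}"
    then have i: "i < n" by simp
    obtain a u where au: "f i = a # u" "length u = K" using f(1)[OF i] by (cases "f i") auto
    show "prob (X i -` {s. stake (Suc K) s = f i} \<inter> space M) = pmf (word_pmf \<mu> K) (f i)"
      unfolding pre using prob_prefix[OF i, of u a] au by (simp add: pmf_word)
  qed
  also have "\<dots> = pmf (words_pmf K n) f"
    unfolding words_pmf_def using f(2) by (subst pmf_Pi') auto
  finally show "prob {\<omega> \<in> space M. words K \<omega> = f} = pmf (words_pmf K n) f" unfolding eq .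
qed

text \<open>
  The words take finitely many values, hence only the probabilities of single values have to be
  compared, and no measurable structure on the space of word families is involved.
\<close>
lemma words_transfer:
  fixes h :: "(nat \<Rightarrow> bool list) \<Rightarrow> 'c :: {banach, second_countable_topology}"
  shows "integrable M (\<lambda>\<omega>. h (words K \<omega>))"
    and "(\<integral>\<omega>. h (words K \<omega>) \<partial>M) = (\<integral>f. h f \<partial>measure_pmf (words_pmf K n))"
proof -
  define B where "B = PiE_dflt {..<n} [] (\<lambda>_. {w :: bool list. length w = Suc K})"
  have "finite {w :: bool list. set w \<subseteq> UNIV \<and> length w = Suc K}"
    by (rule finite_lists_length_eq) simp
  then have B: "finite B" unfolding B_def by (intro finite_PiE_dflt) auto
  have inB: "words K \<omega> \<in> B" for \<omega> by (auto simp: B_def PiE_dflt_def words_def)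
  have supp: "set_pmf (words_pmf K n) \<subseteq> B"
  proof -
    have "set_pmf (word_pmf \<mu> K) \<subseteq> {w. length w = Suc K}" by (auto elim: word_pmf_cases)
    then show ?thesis unfolding words_pmf_def B_def by (subst set_Pi_pmf) (auto simp: PiE_dflt_def)
  qed
  have ev: "{\<omega> \<in> space M. words K \<omega> = f} \<in> events" "prob {\<omega> \<in> space M. words K \<omega> = f} = pmf (words_pmf K n) f"
    if "f \<in> B" for f
  proof -
    have a: "length (f i) = Suc K" if "i < n" for i using \<open>f \<in> B\<close> that by (auto simp: B_def PiE_dflt_def)
    have b: "f i = []" if "n \<le> i" for i using \<open>f \<in> B\<close> that by (auto simp: B_def PiE_dflt_def)
    show "{\<omega> \<in> space M. words K \<omega> = f} \<in> events" "prob {\<omega> \<in> space M. words K \<omega> = f} = pmf (words_pmf K n) f"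
      by (rule prob_words(1)[OF a b], simp_all only:) (rule prob_words(2)[OF a b], simp_all only:)
  qed
  define g where "g = (\<lambda>\<omega>. \<Sum>f\<in>B. indicator {\<omega> \<in> space M. words K \<omega> = f} \<omega> *\<^sub>R h f)"
  have g: "h (words K \<omega>) = g \<omega>" if "\<omega> \<in> space M" for \<omega>
  proof -
    have "g \<omega> = (\<Sum>f\<in>B. if f = words K \<omega> then h f else 0)"
      unfolding g_def by (intro sum.cong refl) (use that in \<open>auto simp: indicator_def\<close>)
    then show ?thesis using B inB by (simp add: sum.delta)
  qed
  have int: "integrable M (\<lambda>\<omega>. indicator {\<omega> \<in> space M. words K \<omega> = f} \<omega> *\<^sub>R h f)" if "f \<in> B" for f
    using ev(1)[OF that] by (intro integrable_scaleR_left) (simp add: integrable_indicator_iff emeasure_eq_measure)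
  have "integrable M g" unfolding g_def by (intro Bochner_Integration.integrable_sum int)
  then show "integrable M (\<lambda>\<omega>. h (words K \<omega>))"
    by (subst Bochner_Integration.integrable_cong[OF refl g]) auto
  have "(\<integral>\<omega>. h (words K \<omega>) \<partial>M) = (\<integral>\<omega>. g \<omega> \<partial>M)"
    by (intro Bochner_Integration.integral_cong refl g)
  also have "\<dots> = (\<Sum>f\<in>B. prob {\<omega> \<in> space M. words K \<omega> = f} *\<^sub>R h f)"
  proof -
    have "(\<integral>\<omega>. indicator {\<omega> \<in> space M. words K \<omega> = f} \<omega> *\<^sub>R h f \<partial>M) = prob {\<omega> \<in> space M. words K \<omega> = f} *\<^sub>R h f"
      if f: "f \<in> B" for f
    proof -
      have "integrable M (indicator {\<omega> \<in> space M. words K \<omega> = f} :: 'a \<Rightarrow> real)"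
        using ev(1)[OF f] by (simp add: integrable_indicator_iff emeasure_eq_measure)
      then show ?thesis
        using sets.sets_into_space[OF ev(1)[OF f]] by (subst integral_scaleR_left) (auto simp: Int_absorb2)
    qed
    then show ?thesis
      unfolding g_def by (subst Bochner_Integration.integral_sum[OF int]) simp_all
  qed
  also have "\<dots> = (\<Sum>f\<in>B. pmf (words_pmf K n) f *\<^sub>R h f)" using ev(2) by simp
  also have "\<dots> = (\<integral>f. h f \<partial>measure_pmf (words_pmf K n))"
    using supp by (intro integral_measure_pmf[symmetric] B) auto
  finally show "(\<integral>\<omega>. h (words K \<omega>) \<partial>M) = (\<integral>f. h f \<partial>measure_pmf (words_pmf K n))" .
qed

text \<open>
  A union bound over all pairs of strings: given one string, another one shares its prefix of length
  \<open>K + 1\<close> with probability at most \<open>exp (- min_info) ^ K\<close>.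
\<close>
lemma expected_level_count:
  "measure_pmf.expectation (words_pmf K n) (\<lambda>f. real (level_count (Suc K) f {..<n}))
     \<le> (real n)\<^sup>2 * exp (- min_info) ^ K"
proof -
  note [simp] = integrable_measure_pmf_finite[OF finite_words_pmf]
  let ?hit = "\<lambda>i f. of_bool (meets (Suc K) f {..<n} i \<noteq> {}) :: real"
  have "measure_pmf.expectation (words_pmf K n) (\<lambda>f. real (level_count (Suc K) f {..<n}))
      = measure_pmf.expectation (words_pmf K n) (\<lambda>f. \<Sum>i<n. ?hit i f)"
    by (simp add: level_count_def Int_def)
  also have "\<dots> = (\<Sum>i<n. measure_pmf.expectation (words_pmf K n) (?hit i))"
    by (subst Bochner_Integration.integral_sum) auto
  also have "\<dots> \<le> (\<Sum>i<n. real n * exp (- min_info) ^ K)"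
  proof (rule sum_mono)
    fix i assume "i \<in> {..<n}"
    then have i: "i < n" by simp
    show "measure_pmf.expectation (words_pmf K n) (?hit i) \<le> real n * exp (- min_info) ^ K"
      unfolding words_pmf_def
    proof (rule expectation_Pi_pmf_le[where x = i])
      fix w assume "w \<in> set_pmf (word_pmf \<mu> K)"
      then obtain a u where w: "w = a # u" "length u = K" by (rule word_pmf_cases)
      let ?Q = "Pi_pmf ({..<n} - {i}) [] (\<lambda>_. word_pmf \<mu> K)"
      have Q: "finite (set_pmf ?Q)" by (rule finite_set_Pi_pmf) (auto simp: finite_word_pmf)
      define E where "E = {w'. take (Suc K) w' = a # u}"
      have "?hit i (f(i := w)) \<le> real (card {l \<in> {..<n} - {i}. f l \<in> E})" for f
      proof -
        have m: "meets (Suc K) (f(i := w)) {..<n} i = {l \<in> {..<n} - {i}. f l \<in> E}"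
          using w by (auto simp: meets_def E_def)
        have hit: "of_bool (N \<noteq> {}) \<le> real (card N)" if "finite N" for N :: "nat set"
          using that card_gt_0_iff[of N] by (cases "N = {}") auto
        show ?thesis unfolding m by (rule hit) simp
      qed
      then have "measure_pmf.expectation ?Q (\<lambda>f. ?hit i (f(i := w)))
          \<le> measure_pmf.expectation ?Q (\<lambda>f. real (card {l \<in> {..<n} - {i}. f l \<in> E}))"
        by (intro pmf_expectation_mono Q)
      also have "\<dots> = real (n - 1) * (\<mu> a * path_weight a u)"
        using i w by (subst expectation_card_hits) (simp_all add: finite_word_pmf E_def prob_take_word)
      also have "\<dots> \<le> real n * (1 * exp (- min_info) ^ K)"
        using path_weight_le[of a u] path_weight_pos[of a u] mu_le_1[of a] mu_nonneg[of a] w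
        by (intro mult_mono) auto
      finally show "measure_pmf.expectation ?Q (\<lambda>f. ?hit i (f(i := w))) \<le> real n * exp (- min_info) ^ K" by simp
    qed (use i in \<open>auto simp: finite_word_pmf\<close>)
  qed
  finally show ?thesis by (simp add: power2_eq_square mult.assoc)
qed

lemma expected_sharing_count:
  "integrable M (\<lambda>\<omega>. real (sharing_count n k (\<lambda>i. X i \<omega>)))"
  "(\<integral>\<omega>. real (sharing_count n (Suc k) (\<lambda>i. X i \<omega>)) \<partial>M) \<le> (real n)\<^sup>2 * exp (- min_info) ^ k"
proof -
  have eq: "sharing_count n m (\<lambda>i. X i \<omega>) = level_count m (words K \<omega>) {..<n}" if "m \<le> Suc K" for m K \<omega>
    using sharing_count_level_count[OF that, of n "\<lambda>i. X i \<omega>"] by (simp add: words_def[abs_def])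
  show "integrable M (\<lambda>\<omega>. real (sharing_count n k (\<lambda>i. X i \<omega>)))"
    using words_transfer(1)[where K = k and h = "\<lambda>f. real (level_count k f {..<n})"] by (simp add: eq[of k k])
  show "(\<integral>\<omega>. real (sharing_count n (Suc k) (\<lambda>i. X i \<omega>)) \<partial>M) \<le> (real n)\<^sup>2 * exp (- min_info) ^ k"
    using words_transfer(2)[where K = k and h = "\<lambda>f. real (level_count (Suc k) f {..<n})"] expected_level_count[of k]
    by (simp add: eq[of "Suc k" k])
qed

end

section \<open>The external path length in the source model\<close>

lemma cmod_char_distr_diff_le:
  assumes "prob_space M" and [measurable]: "X \<in> borel_measurable M" "Y \<in> borel_measurable M"
    and int: "integrable M (\<lambda>\<omega>. X \<omega> - Y \<omega>)"
  shows "cmod (char (distr M borel X) t - char (distr M borel Y) t) \<le> \<bar>t\<bar> * (\<integral>\<omega>. \<bar>X \<omega> - Y \<omega>\<bar> \<partial>M)"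
proof -
  interpret prob_space M by fact
  have ii: "integrable M (\<lambda>\<omega>. iexp (t * Z \<omega>))" if [measurable]: "Z \<in> borel_measurable M" for Z
    by (rule integrable_iexp) auto
  have diff: "cmod (iexp a - iexp b) \<le> \<bar>a - b\<bar>" for a b :: real
  proof -
    have "iexp a - iexp b = iexp b * (iexp (a - b) - 1)"
      by (simp add: right_diff_distrib algebra_simps flip: exp_add)
    then have "cmod (iexp a - iexp b) = cmod (iexp (a - b) - 1)" by (simp add: norm_mult)
    also have "\<dots> \<le> \<bar>a - b\<bar>" using iexp_approx1[of "a - b" 0] by simp
    finally show ?thesis .
  qed
  have "char (distr M borel X) t - char (distr M borel Y) t = (\<integral>\<omega>. iexp (t * X \<omega>) - iexp (t * Y \<omega>) \<partial>M)"
    by (subst Bochner_Integration.integral_diff[OF ii ii]) (simp_all add: char_def integral_distr)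
  also have "cmod \<dots> \<le> (\<integral>\<omega>. \<bar>t\<bar> * \<bar>X \<omega> - Y \<omega>\<bar> \<partial>M)"
  proof (rule order.trans[OF integral_norm_bound integral_mono])
    show "integrable M (\<lambda>\<omega>. cmod (iexp (t * X \<omega>) - iexp (t * Y \<omega>)))"
      by (intro integrable_norm Bochner_Integration.integrable_diff ii) auto
    show "integrable M (\<lambda>\<omega>. \<bar>t\<bar> * \<bar>X \<omega> - Y \<omega>\<bar>)"
      by (intro integrable_mult_right integrable_abs int)
    show "cmod (iexp (t * X \<omega>) - iexp (t * Y \<omega>)) \<le> \<bar>t\<bar> * \<bar>X \<omega> - Y \<omega>\<bar>" for \<omega>
      using diff[of "t * X \<omega>" "t * Y \<omega>"] by (simp add: abs_mult flip: right_diff_distrib)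
  qed
  finally show ?thesis by simp
qed

lemma real_distribution_normal:
  assumes "0 < \<sigma>" shows "real_distribution (density lborel (\<lambda>x. ennreal (normal_density 0 \<sigma> x)))"
  using prob_space_normal_density[OF assms, of 0]
  by (auto simp: real_distribution_def real_distribution_axioms_def)

lemma char_normal:
  assumes \<sigma>: "0 < \<sigma>"
  shows "char (density lborel (\<lambda>x. ennreal (normal_density 0 \<sigma> x))) t = exp (- (\<sigma>\<^sup>2 * t\<^sup>2 / 2))"
proof -
  define D where "D = density lborel (\<lambda>x. ennreal (normal_density 0 \<sigma> x))"
  interpret D: prob_space D unfolding D_def by (rule prob_space_normal_density[OF \<sigma>])
  have "distr D lborel (\<lambda>x. x) = D" unfolding D_def by (rule distr_id2) simp
  then have "distributed D lborel (\<lambda>x. x) (\<lambda>x. ennreal (normal_density 0 \<sigma> x))"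
    by (simp add: distributed_def D_def)
  then have "distributed D lborel (\<lambda>x. (x - 0) / \<sigma>) (\<lambda>x. ennreal (std_normal_density x))"
    using D.normal_standard_normal_convert[OF \<sigma>, of "\<lambda>x. x" 0] by simp
  then have std: "distr D lborel (\<lambda>x. x / \<sigma>) = std_normal_distribution"
    by (simp add: distributed_def)
  have "char D t = (\<integral>x. iexp (\<sigma> * t * (x / \<sigma>)) \<partial>D)"
    using \<sigma> by (simp add: char_def)
  also have "\<dots> = char (distr D lborel (\<lambda>x. x / \<sigma>)) (\<sigma> * t)"
    unfolding char_def by (subst integral_distr) (auto simp: D_def)
  also have "\<dots> = exp (- (\<sigma>\<^sup>2 * t\<^sup>2 / 2))"
    unfolding std char_std_normal_distribution by (simp add: power_mult_distrib)
  finally show ?thesis unfolding D_def .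
qed

context trie_model
begin

definition path_length :: "'a \<Rightarrow> real" where
  "path_length \<omega> = real (external_path_length n (\<lambda>i. X i \<omega>))"

text \<open>There are countably many prefixes, so equality of two of them is a measurable event.\<close>
lemma pred_shares_prefix:
  assumes i: "i < n" shows "Measurable.pred M (\<lambda>\<omega>. shares_prefix n k (\<lambda>i. X i \<omega>) i)"
proof -
  have eq: "Measurable.pred M (\<lambda>\<omega>. stake k (X j \<omega>) = stake k (X i \<omega>))" if j: "j < n" for j
    unfolding pred_def
  proof -
    have "{\<omega> \<in> space M. stake k (X j \<omega>) = stake k (X i \<omega>)}
        = (\<Union>w. {\<omega> \<in> space M. stake k (X j \<omega>) = w} \<inter> {\<omega> \<in> space M. stake k (X i \<omega>) = w})"
      by auto
    also have "\<dots> \<in> events"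
      by (rule sets.countable_UN') (use stake_event[OF i] stake_event[OF j] in \<open>auto intro!: sets.Int\<close>)
    finally show "{\<omega> \<in> space M. stake k (X j \<omega>) = stake k (X i \<omega>)} \<in> events" .
  qed
  have "Measurable.pred M (\<lambda>\<omega>. \<exists>j\<in>{..<n}. j \<noteq> i \<and> stake k (X j \<omega>) = stake k (X i \<omega>))"
    by (intro pred_intros_finite pred_intros_logic eq) auto
  then show ?thesis unfolding shares_prefix_def Bex_def lessThan_iff .
qed

lemma path_length_measurable: "path_length \<in> borel_measurable M"
proof -
  have "(\<lambda>\<omega>. real (length (trie_node n (\<lambda>i. X i \<omega>) i))) \<in> borel_measurable M" if "i < n" for i
  proof -
    note [measurable] = pred_shares_prefix[OF that]
    show ?thesis unfolding trie_node_cases by measurable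
  qed
  then show ?thesis
    unfolding path_length_def[abs_def] external_path_length_def of_nat_sum by (intro borel_measurable_sum) auto
qed

abbreviation sharing :: "nat \<Rightarrow> 'a \<Rightarrow> real" where
  "sharing k \<omega> \<equiv> real (sharing_count n k (\<lambda>i. X i \<omega>))"

text \<open>The contribution of the root, which is not random: \<open>0\<close> for a single string and \<open>n\<close> otherwise.\<close>
definition root_count :: real where
  "root_count = real (card {i. i < n \<and> (\<exists>j<n. j \<noteq> i)})"

lemma sharing_0: "sharing 0 \<omega> = root_count"
  by (simp add: root_count_def sharing_count_def shares_prefix_def)

lemma geometric_ratio: "0 < exp (- min_info)" "exp (- min_info) < 1"
  using min_info_pos by auto

text \<open>The strings are almost surely distinct, by the Borel-Cantelli lemma.\<close>
lemma AE_sharing_eventually_0: "AE \<omega> in M. \<exists>m. \<forall>k\<ge>m. sharing k \<omega> = 0"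
proof -
  note [measurable] = borel_measurable_integrable[OF expected_sharing_count(1)]
  define A where "A = (\<lambda>k. {\<omega> \<in> space M. 1 \<le> sharing (Suc k) \<omega>})"
  have A: "A k \<in> events" for k unfolding A_def by measurable
  have le: "prob (A k) \<le> (real n)\<^sup>2 * exp (- min_info) ^ k" for k
  proof -
    have "prob (A k) = (\<integral>\<omega>. indicator (A k) \<omega> \<partial>M)"
      using sets.sets_into_space[OF A[of k]] by (simp add: Int_absorb2)
    also have "\<dots> \<le> (\<integral>\<omega>. sharing (Suc k) \<omega> \<partial>M)"
      using A[of k] by (intro integral_mono expected_sharing_count(1))
        (auto simp: A_def emeasure_eq_measure split: split_indicator)
    also have "\<dots> \<le> (real n)\<^sup>2 * exp (- min_info) ^ k" by (rule expected_sharing_count(2))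
    finally show ?thesis .
  qed
  have "AE \<omega> in M. eventually (\<lambda>k. \<omega> \<in> space M - A k) sequentially"
  proof (rule borel_cantelli_AE1[OF A])
    show "emeasure M (A k) < \<infinity>" for k by (simp add: emeasure_eq_measure)
    show "summable (\<lambda>k. prob (A k))"
    proof (rule summable_comparison_test')
      show "summable (\<lambda>k. (real n)\<^sup>2 * exp (- min_info) ^ k)"
        using geometric_ratio by (intro summable_mult summable_geometric) simp
      show "norm (prob (A k)) \<le> (real n)\<^sup>2 * exp (- min_info) ^ k" for k using le[of k] by simp
    qed
  qed
  then show ?thesis
  proof eventually_elim
    case (elim \<omega>)
    then obtain m where m: "\<And>k. m \<le> k \<Longrightarrow> \<omega> \<in> space M - A k" by (auto simp: eventually_sequentially)
    have "sharing k \<omega> = 0" if k: "Suc m \<le> k" for k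
    proof -
      obtain k' where k': "k = Suc k'" "m \<le> k'" using k by (cases k) auto
      have "\<not> 1 \<le> sharing (Suc k') \<omega>" using m[OF k'(2)] by (auto simp: A_def)
      then show ?thesis by (simp add: k'(1))
    qed
    then show ?case by blast
  qed
qed

text \<open>
  Almost surely, the part of the path length below level \<open>K\<close> is the sum \<open>R\<close> of the remaining levels. Its
  mean is bounded by the tail of a geometric series, which also gives the integrability of the path
  length.
\<close>
lemma path_length_truncation:
  "integrable M path_length"
  "(\<integral>\<omega>. \<bar>path_length \<omega> - root_count - level_sum K (words K \<omega>) {..<n}\<bar> \<partial>M)
      \<le> (real n)\<^sup>2 * exp (- min_info) ^ K / (1 - exp (- min_info))"
proof -
  define R where "R = (\<lambda>\<omega>. \<Sum>k. sharing (Suc (K + k)) \<omega>)"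
  have ls: "level_sum K (words K \<omega>) {..<n} = (\<Sum>k<K. sharing (Suc k) \<omega>)" for \<omega>
    unfolding level_sum_def
    by (intro sum.cong refl) (simp add: sharing_count_level_count[of _ "Suc K"] words_def[abs_def])
  have AE: "AE \<omega> in M. summable (\<lambda>k. norm (sharing (Suc (K + k)) \<omega>)) \<and>
      path_length \<omega> = root_count + level_sum K (words K \<omega>) {..<n} + R \<omega>"
    using AE_sharing_eventually_0
  proof eventually_elim
    case (elim \<omega>)
    then obtain m where m: "\<And>k. m \<le> k \<Longrightarrow> sharing k \<omega> = 0" by blast
    have z: "sharing (Suc (K + k)) \<omega> = 0" if "k \<notin> {..<m}" for k using that by (intro m) auto
    have "summable (\<lambda>k. norm (sharing (Suc (K + k)) \<omega>))"
      by (rule summable_finite[of "{..<m}"]) (use z in auto)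
    moreover have R: "R \<omega> = (\<Sum>k<m. sharing (Suc (K + k)) \<omega>)"
      unfolding R_def by (rule suminf_finite) (use z in auto)
    moreover have "path_length \<omega> = (\<Sum>k<Suc (K + m). sharing k \<omega>)"
      unfolding path_length_def by (rule external_path_length_eq_sum) (use m in force)
    moreover have "(\<Sum>k<Suc (K + m). sharing k \<omega>) = sharing 0 \<omega> + (\<Sum>k<K + m. sharing (Suc k) \<omega>)"
      by (rule sum.lessThan_Suc_shift)
    moreover have "(\<Sum>k<K + m. sharing (Suc k) \<omega>) = (\<Sum>k<K. sharing (Suc k) \<omega>) + (\<Sum>k<m. sharing (Suc (K + k)) \<omega>)"
      by (induction m) auto
    ultimately show ?case unfolding sharing_0 ls by linarith
  qed
  let ?b = "\<lambda>k. (real n)\<^sup>2 * exp (- min_info) ^ K * exp (- min_info) ^ k"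
  have le: "(\<integral>\<omega>. sharing (Suc (K + k)) \<omega> \<partial>M) \<le> ?b k" for k
    using expected_sharing_count(2)[of "K + k"] by (simp add: power_add mult.assoc)
  have nn: "0 \<le> (\<integral>\<omega>. sharing (Suc (K + k)) \<omega> \<partial>M)" for k by simp
  have b: "?b sums ((real n)\<^sup>2 * exp (- min_info) ^ K * (1 / (1 - exp (- min_info))))"
    using geometric_ratio by (intro sums_mult geometric_sums) simp
  have summ: "summable (\<lambda>k. \<integral>\<omega>. norm (sharing (Suc (K + k)) \<omega>) \<partial>M)"
    by (rule summable_comparison_test'[OF sums_summable[OF b]]) (use le nn in simp)
  have AE1: "AE \<omega> in M. summable (\<lambda>k. norm (sharing (Suc (K + k)) \<omega>))" using AE by eventually_elim simp
  have R: "integrable M R" unfolding R_def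
    by (rule integrable_suminf[OF expected_sharing_count(1) AE1 summ])
  have intR: "(\<integral>\<omega>. R \<omega> \<partial>M) \<le> (real n)\<^sup>2 * exp (- min_info) ^ K / (1 - exp (- min_info))"
  proof -
    have "(\<integral>\<omega>. R \<omega> \<partial>M) = (\<Sum>k. \<integral>\<omega>. sharing (Suc (K + k)) \<omega> \<partial>M)"
      unfolding R_def by (rule integral_suminf[OF expected_sharing_count(1) AE1 summ])
    also have "\<dots> \<le> (\<Sum>k. ?b k)"
      by (rule suminf_le[OF le _ sums_summable[OF b]]) (use summ in simp)
    also have "\<dots> = (real n)\<^sup>2 * exp (- min_info) ^ K / (1 - exp (- min_info))"
      using sums_unique[OF b] by simp
    finally show ?thesis .
  qed
  have lsi: "integrable M (\<lambda>\<omega>. level_sum K (words K \<omega>) {..<n})"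
    by (rule words_transfer(1)[where h = "\<lambda>f. level_sum K f {..<n}"])
  have "integrable M (\<lambda>\<omega>. root_count + level_sum K (words K \<omega>) {..<n} + R \<omega>)"
    using R lsi by simp
  then show int: "integrable M path_length"
    by (rule integrable_cong_AE_imp[OF _ path_length_measurable]) (use AE in eventually_elim, simp)
  have "(\<integral>\<omega>. \<bar>path_length \<omega> - root_count - level_sum K (words K \<omega>) {..<n}\<bar> \<partial>M) = (\<integral>\<omega>. R \<omega> \<partial>M)"
  proof (rule integral_cong_AE)
    show "(\<lambda>\<omega>. \<bar>path_length \<omega> - root_count - level_sum K (words K \<omega>) {..<n}\<bar>) \<in> borel_measurable M"
      using path_length_measurable borel_measurable_integrable[OF lsi] by measurable
    show "R \<in> borel_measurable M" using R by simp
    show "AE \<omega> in M. \<bar>path_length \<omega> - root_count - level_sum K (words K \<omega>) {..<n}\<bar> = R \<omega>"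
      using AE
    proof eventually_elim
      case (elim \<omega>)
      then have "0 \<le> R \<omega>" unfolding R_def by (intro suminf_nonneg) (auto dest: summable_norm_cancel)
      then show ?case using elim by simp
    qed
  qed
  then show "(\<integral>\<omega>. \<bar>path_length \<omega> - root_count - level_sum K (words K \<omega>) {..<n}\<bar> \<partial>M)
      \<le> (real n)\<^sup>2 * exp (- min_info) ^ K / (1 - exp (- min_info))" using intR by simp
qed

definition stopped_total :: "(nat \<Rightarrow> bool list) \<Rightarrow> real" where
  "stopped_total f = (\<Sum>i<n. stopped_word (ln (real n)) (f i))"

text \<open>
  Neither the truncation error, small in mean, nor the deviation of
  \<open>level_sum + stopped_total / rate\<close> from its mean, small in mean square, matters on the scale
  \<open>sqrt (n ln n)\<close>; \<open>stopped_total\<close> is centred and needs no correction.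
\<close>
lemma path_length_near_stopped_total:
  assumes K: "(real n)\<^sup>2 * exp (- min_info) ^ K / (1 - exp (- min_info)) \<le> 1"
    and var: "measure_pmf.variance (words_pmf K n) (\<lambda>f. level_sum K f {..<n} + stopped_total f / rate) \<le> V"
  shows "integrable M (\<lambda>\<omega>. path_length \<omega> - expectation path_length + stopped_total (words K \<omega>) / rate)"
    and "(\<integral>\<omega>. \<bar>path_length \<omega> - expectation path_length + stopped_total (words K \<omega>) / rate\<bar> \<partial>M) \<le> 2 + sqrt V"
proof -
  note L = path_length_truncation(1)
  define S where "S = (\<lambda>\<omega>. stopped_total (words K \<omega>) / rate)"
  define ls where "ls = (\<lambda>\<omega>. level_sum K (words K \<omega>) {..<n})"
  define D where "D = (\<lambda>\<omega>. path_length \<omega> - root_count - ls \<omega>)"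
  have S: "integrable M S" unfolding S_def
    by (rule words_transfer(1)[where h = "\<lambda>f. stopped_total f / rate"])
  have ls: "integrable M ls" unfolding ls_def
    by (rule words_transfer(1)[where h = "\<lambda>f. level_sum K f {..<n}"])
  have D: "integrable M D" unfolding D_def using L ls by simp
  have D1: "(\<integral>\<omega>. \<bar>D \<omega>\<bar> \<partial>M) \<le> 1"
    using path_length_truncation(2)[of K] K unfolding D_def ls_def by linarith
  have ED: "\<bar>expectation D\<bar> \<le> 1" using integral_abs_bound[of M D] D1 by linarith
  note [simp] = integrable_measure_pmf_finite[OF finite_words_pmf]
  have mean: "measure_pmf.expectation (words_pmf K n) stopped_total = 0"
  proof -
    have "measure_pmf.expectation (words_pmf K n) stopped_total
        = (\<Sum>i<n. measure_pmf.expectation (words_pmf K n) (\<lambda>f. stopped_word (ln (real n)) (f i)))"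
      unfolding stopped_total_def[abs_def] by (rule Bochner_Integration.integral_sum) simp
    also have "\<dots> = (\<Sum>i<n. 0)"
      unfolding words_pmf_def by (intro sum.cong refl) (simp add: expectation_component stopped_word_mean)
    finally show ?thesis by simp
  qed
  define e where "e = measure_pmf.expectation (words_pmf K n) (\<lambda>f. level_sum K f {..<n} + stopped_total f / rate)"
  have e: "e = expectation ls"
    unfolding ls_def e_def words_transfer(2)[where h = "\<lambda>f. level_sum K f {..<n}"] using mean by simp
  have LE: "expectation path_length = root_count + expectation ls + expectation D"
    unfolding D_def using L ls by (simp add: prob_space)
  have fl: "(\<integral>\<omega>. \<bar>ls \<omega> + S \<omega> - e\<bar> \<partial>M) \<le> sqrt V"
  proof -
    let ?h = "\<lambda>f. \<bar>level_sum K f {..<n} + stopped_total f / rate - e\<bar>"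
    have "(\<integral>\<omega>. \<bar>ls \<omega> + S \<omega> - e\<bar> \<partial>M) = measure_pmf.expectation (words_pmf K n) ?h"
      unfolding ls_def S_def by (rule words_transfer(2)[where h = ?h])
    also have "\<dots> \<le> sqrt V"
    proof (rule real_le_rsqrt)
      have "(measure_pmf.expectation (words_pmf K n) ?h)\<^sup>2 \<le> measure_pmf.expectation (words_pmf K n) (\<lambda>f. (?h f)\<^sup>2)"
        by (rule pmf_square_expectation_le[OF finite_words_pmf])
      also have "\<dots> \<le> V" using var by (simp add: e_def)
      finally show "(measure_pmf.expectation (words_pmf K n) ?h)\<^sup>2 \<le> V" .
    qed
    finally show ?thesis .
  qed
  have dec: "path_length \<omega> - expectation path_length + S \<omega> = D \<omega> - expectation D + (ls \<omega> + S \<omega> - e)" for \<omega>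
    unfolding LE e D_def by simp
  show "integrable M (\<lambda>\<omega>. path_length \<omega> - expectation path_length + stopped_total (words K \<omega>) / rate)"
    using L S unfolding S_def by simp
  have "(\<integral>\<omega>. \<bar>path_length \<omega> - expectation path_length + S \<omega>\<bar> \<partial>M)
      \<le> (\<integral>\<omega>. \<bar>D \<omega>\<bar> + 1 + \<bar>ls \<omega> + S \<omega> - e\<bar> \<partial>M)"
  proof (rule integral_mono)
    show "\<bar>path_length \<omega> - expectation path_length + S \<omega>\<bar> \<le> \<bar>D \<omega>\<bar> + 1 + \<bar>ls \<omega> + S \<omega> - e\<bar>" for \<omega>
      unfolding dec using ED by linarith
  qed (use L S ls D in simp_all)
  also have "\<dots> = (\<integral>\<omega>. \<bar>D \<omega>\<bar> \<partial>M) + 1 + (\<integral>\<omega>. \<bar>ls \<omega> + S \<omega> - e\<bar> \<partial>M)"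
    using D S ls by (simp add: prob_space)
  also have "\<dots> \<le> 2 + sqrt V" using D1 fl by linarith
  finally show "(\<integral>\<omega>. \<bar>path_length \<omega> - expectation path_length + stopped_total (words K \<omega>) / rate\<bar> \<partial>M) \<le> 2 + sqrt V"
    unfolding S_def .
qed

lemma char_path_length_near:
  assumes K: "(real n)\<^sup>2 * exp (- min_info) ^ K / (1 - exp (- min_info)) \<le> 1"
    and var: "measure_pmf.variance (words_pmf K n) (\<lambda>f. level_sum K f {..<n} + stopped_total f / rate) \<le> V"
    and r: "0 < r"
  shows "cmod (char (distr M borel (\<lambda>\<omega>. (path_length \<omega> - expectation path_length) / r)) t
       - char (distr (words_pmf K n) borel (\<lambda>f. (- 1 / (rate * r)) * stopped_total f)) t) \<le> \<bar>t\<bar> * ((2 + sqrt V) / r)"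
proof -
  note near = path_length_near_stopped_total[OF K var]
  define S where "S = (\<lambda>\<omega>. (- 1 / (rate * r)) * stopped_total (words K \<omega>))"
  have S: "S \<in> borel_measurable M"
    unfolding S_def by (rule borel_measurable_integrable[OF words_transfer(1)[where h = "\<lambda>f. (- 1 / (rate * r)) * stopped_total f"]])
  have L: "(\<lambda>\<omega>. (path_length \<omega> - expectation path_length) / r) \<in> borel_measurable M"
    using path_length_measurable by measurable
  have "char (distr (words_pmf K n) borel (\<lambda>f. (- 1 / (rate * r)) * stopped_total f)) t
      = (\<integral>f. iexp (t * ((- 1 / (rate * r)) * stopped_total f)) \<partial>measure_pmf (words_pmf K n))"
    unfolding char_def by (subst integral_distr) auto
  also have "\<dots> = (\<integral>\<omega>. iexp (t * S \<omega>) \<partial>M)"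
    unfolding S_def by (rule words_transfer(2)[symmetric])
  also have "\<dots> = char (distr M borel S) t"
    unfolding char_def using S by (subst integral_distr) auto
  finally have cS: "char (distr (words_pmf K n) borel (\<lambda>f. (- 1 / (rate * r)) * stopped_total f)) t = char (distr M borel S) t" .
  have diff: "(path_length \<omega> - expectation path_length) / r - S \<omega>
      = (path_length \<omega> - expectation path_length + stopped_total (words K \<omega>) / rate) / r" for \<omega>
    using rate_pos r by (simp add: S_def field_simps)
  have "cmod (char (distr M borel (\<lambda>\<omega>. (path_length \<omega> - expectation path_length) / r)) t - char (distr M borel S) t)
     \<le> \<bar>t\<bar> * (\<integral>\<omega>. \<bar>(path_length \<omega> - expectation path_length) / r - S \<omega>\<bar> \<partial>M)"
    by (rule cmod_char_distr_diff_le[OF _ L S]) (unfold diff, intro prob_space_axioms, intro integrable_divide near(1))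
  also have "(\<integral>\<omega>. \<bar>(path_length \<omega> - expectation path_length) / r - S \<omega>\<bar> \<partial>M)
      = (\<integral>\<omega>. \<bar>path_length \<omega> - expectation path_length + stopped_total (words K \<omega>) / rate\<bar> \<partial>M) / r"
    unfolding diff using r by (simp add: abs_divide)
  also have "\<bar>t\<bar> * \<dots> \<le> \<bar>t\<bar> * ((2 + sqrt V) / r)"
    using near(2) r by (intro mult_left_mono divide_right_mono) auto
  finally show ?thesis unfolding cS .
qed

end

section \<open>The limit theorem\<close>

theorem theorem6p1:
  fixes p :: "bool \<Rightarrow> bool \<Rightarrow> real"
    and \<mu> :: "bool \<Rightarrow> real"
    and M :: "nat \<Rightarrow> 'a measure"
    and X :: "nat \<Rightarrow> nat \<Rightarrow> 'a \<Rightarrow> bool stream"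
    and L :: "nat \<Rightarrow> 'a \<Rightarrow> real"
  assumes p_range: "\<And>i j. 0 < p i j \<and> p i j < 1"
    and p_rows: "\<And>i. p i False + p i True = 1"
    and p_not_half: "\<exists>i j. p i j \<noteq> 1 / 2"
    and mu_range: "\<And>i. 0 \<le> \<mu> i \<and> \<mu> i \<le> 1"
    and mu_sum: "\<mu> False + \<mu> True = 1"
    and source: "\<And>n. markov_source (M n) \<mu> p n (X n)"
    and L_def: "\<And>n \<omega>. L n \<omega> = real (external_path_length n (\<lambda>i. X n i \<omega>))"
  shows "limit_variance p > 0 \<and>
    weak_conv_m
      (\<lambda>n. distr (M n) borel
         (\<lambda>\<omega>. (L n \<omega> - prob_space.expectation (M n) (L n)) / sqrt (real n * ln (real n))))
      (density lborel (\<lambda>x. ennreal (normal_density 0 (sqrt (limit_variance p)) x)))"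
proof -
  interpret markov_words p \<mu>
    using p_range p_rows mu_range mu_sum by unfold_locales auto
  have ps: "prob_space (M n)" for n using source[of n] by (simp add: markov_source_def)
  have model: "trie_model p \<mu> (M n) n (X n)" if "1 \<le> n" for n
    by (intro trie_model.intro markov_words_axioms ps trie_model_axioms.intro that source)
  have Lp: "L n = trie_model.path_length n (X n)" if "1 \<le> n" for n
    by (simp add: fun_eq_iff L_def trie_model.path_length_def[OF model[OF that]])

  have pos: "0 < limit_variance p"
    unfolding limit_variance_eq using var_rate_pos[OF p_not_half] rate_pos by simp
  have var: "stopped_rate / rate\<^sup>2 = limit_variance p"
    unfolding limit_variance_eq stopped_rate_def using rate_pos by (simp add: field_simps power2_eq_square power3_eq_cube)

  let ?Y = "\<lambda>n \<omega>. (L n \<omega> - prob_space.expectation (M n) (L n)) / sqrt (real n * ln (real n))"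
  have Y: "?Y n \<in> borel_measurable (M n)" for n
  proof (cases "n = 0")
    case False
    then show ?thesis
      using trie_model.path_length_measurable[OF model[of n]] by (simp add: Lp)
  qed simp

  \<comment> \<open>levels beyond \<open>K n\<close> contribute at most \<open>1\<close> to the expected path length, and \<open>stopped_sum\<close> has stopped by then\<close>
  have "\<exists>K. ln (real n) \<le> min_info * real K \<and> (real n)\<^sup>2 * exp (- min_info) ^ K / (1 - exp (- min_info)) \<le> 1" for n
  proof -
    have "(\<lambda>K. (real n)\<^sup>2 * exp (- min_info) ^ K / (1 - exp (- min_info))) \<longlonglongrightarrow> (real n)\<^sup>2 * 0 / (1 - exp (- min_info))"
      using min_info_pos by (intro tendsto_intros LIMSEQ_realpow_zero) auto
    then have "eventually (\<lambda>K. (real n)\<^sup>2 * exp (- min_info) ^ K / (1 - exp (- min_info)) < 1) sequentially"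
      by (rule order_tendstoD) simp
    moreover have "eventually (\<lambda>K. ln (real n) / min_info \<le> real K) sequentially"
      by (rule eventually_ge_at_top[THEN eventually_compose_filterlim[OF _ filterlim_real_sequentially]])
    ultimately have "eventually (\<lambda>K. (real n)\<^sup>2 * exp (- min_info) ^ K / (1 - exp (- min_info)) < 1
        \<and> ln (real n) / min_info \<le> real K) sequentially" by (rule eventually_conj)
    then obtain K where "(real n)\<^sup>2 * exp (- min_info) ^ K / (1 - exp (- min_info)) < 1" "ln (real n) / min_info \<le> real K"
      by (auto simp: eventually_sequentially)
    then show ?thesis using min_info_pos by (intro exI[of _ K]) (auto simp: field_simps)
  qed
  then obtain K where K: "\<And>n. ln (real n) \<le> min_info * real (K n)"
      "\<And>n. (real n)\<^sup>2 * exp (- min_info) ^ K n / (1 - exp (- min_info)) \<le> 1" by metis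
  obtain C where C: "0 \<le> C" and C_le: "\<And>n K. 1 \<le> n \<Longrightarrow> ln (real n) \<le> min_info * real K \<Longrightarrow>
     measure_pmf.variance (words_pmf K n)
       (\<lambda>f. level_sum K f {..<n} + (\<Sum>i<n. stopped_word (ln (real n)) (f i)) / rate) \<le> C * real n"
    using variance_level_sum by blast

  let ?S = "\<lambda>n. distr (words_pmf (K n) n) borel
       (\<lambda>f. (- 1 / (rate * sqrt (real n * ln (real n)))) * (\<Sum>i<n. stopped_word (ln (real n)) (f i)))"
  have near: "cmod (char (distr (M n) borel (?Y n)) t - char (?S n) t)
      \<le> \<bar>t\<bar> * ((2 + sqrt (C * real n)) / sqrt (real n * ln (real n)))" if n: "2 \<le> n" for n t
  proof -
    have n1: "1 \<le> n" using n by simp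
    interpret trie_model p \<mu> "M n" n "X n" by (rule model[OF n1])
    have "0 < sqrt (real n * ln (real n))" using n by simp
    from char_path_length_near[OF K(2) _ this, of "C * real n" t] C_le[OF n1 K(1)]
    show ?thesis by (simp add: Lp[OF n1] stopped_total_def[abs_def])
  qed
  have conv: "(\<lambda>n. char (distr (M n) borel (?Y n)) t)
      \<longlonglongrightarrow> char (density lborel (\<lambda>x. ennreal (normal_density 0 (sqrt (limit_variance p)) x))) t" for t
  proof -
    have "(\<lambda>n. \<bar>t\<bar> * (2 * (1 / sqrt (real n * ln (real n))) + sqrt C * (sqrt (real n) / sqrt (real n * ln (real n)))))
        \<longlonglongrightarrow> \<bar>t\<bar> * (2 * 0 + sqrt C * 0)"
    proof (intro tendsto_mult tendsto_add tendsto_const)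
      show "(\<lambda>n. 1 / sqrt (real n * ln (real n))) \<longlonglongrightarrow> 0" by real_asymp
      show "(\<lambda>n. sqrt (real n) / sqrt (real n * ln (real n))) \<longlonglongrightarrow> 0" by real_asymp
    qed
    moreover have "(2 + sqrt (C * real n)) / r = 2 * (1 / r) + sqrt C * (sqrt (real n) / r)" for n r
      by (simp add: real_sqrt_mult add_divide_distrib)
    ultimately have lim: "(\<lambda>n. \<bar>t\<bar> * ((2 + sqrt (C * real n)) / sqrt (real n * ln (real n)))) \<longlonglongrightarrow> 0"
      by (simp only: mult_zero_right add_0_right)
    have d: "(\<lambda>n. char (distr (M n) borel (?Y n)) t - char (?S n) t) \<longlonglongrightarrow> 0"
      by (rule Lim_null_comparison[OF _ lim]) (use near in \<open>auto intro!: eventually_sequentiallyI[of 2]\<close>)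
    have s: "(\<lambda>n. char (?S n) t) \<longlonglongrightarrow> exp (- (limit_variance p * t\<^sup>2 / 2))"
      using char_stopped_sums_tendsto[OF K(1), of t] unfolding var .
    have "(\<lambda>n. char (distr (M n) borel (?Y n)) t) \<longlonglongrightarrow> exp (- (limit_variance p * t\<^sup>2 / 2))"
      by (rule Lim_transform[OF s d])
    then show ?thesis using pos by (simp add: char_normal)
  qed
  have "weak_conv_m (\<lambda>n. distr (M n) borel (?Y n))
      (density lborel (\<lambda>x. ennreal (normal_density 0 (sqrt (limit_variance p)) x)))"
  proof (rule levy_continuity[OF _ _ conv])
    show "real_distribution (distr (M n) borel (?Y n))" for n
      by (rule prob_space.real_distribution_distr[OF ps Y])
    show "real_distribution (density lborel (\<lambda>x. ennreal (normal_density 0 (sqrt (limit_variance p)) x)))"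
      by (rule real_distribution_normal) (use pos in simp)
  qed
  then show ?thesis using pos by blast
qed

end
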